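(* Let $a>0$, $x>0$, $0<\theta<1$, let $k\geq 1$ be an odd integer, and let $\nu\in\mathbb{C}$ with $\Re(\nu)>0$. Then \begin{align*} &\left(\frac{a^2x}{4}\right)^{\frac{\nu}{2}+k+1}\sum_{n=1}^{\infty} n^{\nu/2}K_{\nu}(a\sqrt{nx})\sum_{d\mid n}d^k\cos(2\pi d\theta) =\frac{(-1)^{\frac{k-1}{2}}a^{2k+2}k!}{2^{2k+4}(2\pi)^{k+1}}\Gamma(\nu)\bigl\{\zeta(k+1,\theta)+\zeta(k+1,1-\theta)\bigr\}x^{k+1}\\ &\quad+\frac{(-1)^{\frac{k+1}{2}}(2\pi)^{k+1}\Gamma(\nu+k+1)}{4}\sum_{d=1}^{\infty}d^k\sum_{m=0}^{\infty}\left\{\frac{1}{\left(\frac{16\pi^2}{a^2}\frac{d(m+\theta)}{x}+1\right)^{\nu+k+1}}+\frac{1}{\left(\frac{16\pi^2}{a^2}\frac{d(m+1-\theta)}{x}+1\right)^{\nu+k+1}}\right\} -\delta_{k,1}\frac{a^2}{16}\Gamma(1+\nu)x, \end{align*} where $\delta_{k,1}=1$ if $k=1$ and $\delta_{k,1}=0$ otherwise.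
   Context: $K_\nu$ denotes the modified Bessel function of the second kind of order $\nu$. $\zeta(s,\alpha)=\sum_{n=0}^\infty (n+\alpha)^{-s}$ (for $\Re s>1$, $0<\alpha\le 1$) is the Hurwitz zeta function. *)

theory Defs
  imports "HOL-Analysis.Analysis"
begin

text \<open>Modified Bessel function of the second kind, via the standard integral
  representation K_nu(z) = int_0^infty exp(-z cosh t) cosh(nu t) dt (z > 0, nu complex).\<close>
definition besselK :: "complex \<Rightarrow> real \<Rightarrow> complex" where
  "besselK \<nu> z = integral {0..} (\<lambda>t::real. complex_of_real (exp (- z * cosh t)) * cosh (\<nu> * complex_of_real t))"

definition hurwitz_zeta :: "real \<Rightarrow> real \<Rightarrow> real" where
  "hurwitz_zeta s \<alpha> = (\<Sum>n. (real n + \<alpha>) powr (- s))"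

end

theory Submission
  imports Defs
begin

text \<open>
  Write \<open>X = a\<^sup>2 x / 4\<close> and let \<open>\<sigma>(n)\<close> be the sum of \<open>d\<^sup>k cos (2 \<pi> d \<theta>)\<close> over the divisors \<open>d\<close> of \<open>n\<close>.
  Since \<open>2 (n X)\<close> to the power \<open>\<nu>/2\<close> times \<open>K\<^sub>\<nu>(a \<surd>(n x))\<close> is the integral of
  \<open>t powr (\<nu> - 1) exp (- t - n X / t)\<close> over the positive axis, the left-hand side is, up to a power
  of \<open>X\<close>, the integral of \<open>t powr (\<nu> - 1) exp (- t) S(X / t)\<close>, where \<open>S(y)\<close> is the Lambert-type
  series \<open>\<Sum> \<sigma>(n) exp (- n y)\<close>. Applying Lipschitz' formula to each row of that series turns it into
  a lattice sum of real parts of the \<open>- (k + 1)\<close>-th powers of \<open>m y + 2 \<pi> i (n \<plusminus> \<theta>)\<close>; exchanging the two summations and applying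
  Lipschitz' formula to each column gives an exponential double series in \<open>1 / y\<close>, the terms with
  \<open>m = 0\<close> being the Hurwitz zeta values. For \<open>k = 1\<close> the lattice sum is only conditionally convergent,
  and the exchange costs \<open>1 / (2 y)\<close>, which produces the term with the Kronecker delta. Integrating
  termwise against \<open>t powr (\<nu> - 1) exp (- t)\<close> yields Gamma integrals.
\<close>

section \<open>Lipschitz' formula\<close>

text \<open>Gamma(w) Gamma(1 - w) sin(pi w) is constant off the integers, so its derivative
  vanishes, and the nonzero factor Gamma(z) Gamma(1 - z) cancels. Keeping the sine as a factor
  avoids a cotangent.\<close>

lemma Digamma_reflection:
  fixes z :: complex
  assumes "z \<notin> \<int>"
  shows "(Digamma (1 - z) - Digamma z) * sin (of_real pi * z) = of_real pi * cos (of_real pi * z)"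
proof -
  have open_nonint: "open (- \<int> :: complex set)"
    by (simp add: closed_Ints open_Compl)
  have z1: "1 - z \<notin> \<int>"
    using assms by (metis Ints_1 Ints_diff diff_diff_eq2 add_diff_cancel_left')
  have nonpos: "z \<notin> \<int>\<^sub>\<le>\<^sub>0" "1 - z \<notin> \<int>\<^sub>\<le>\<^sub>0"
    using assms z1 nonpos_Ints_Int by blast+
  have eq: "Gamma w * Gamma (1 - w) * sin (of_real pi * w) = of_real pi" if "w \<notin> \<int>" for w :: complex
  proof -
    have "sin (of_real pi * w) \<noteq> 0"
    proof
      assume "sin (of_real pi * w) = 0"
      then obtain n :: int where "of_real pi * w = of_real (of_int n * pi)"
        by (auto simp: sin_eq_0)
      hence "w = of_int n" by simp
      with that show False by simp
    qed
    with Gamma_reflection_complex[of w] show ?thesis by simp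
  qed
  let ?G = "\<lambda>w::complex. Gamma w * Gamma (1 - w) * sin (of_real pi * w)"
  let ?D = "(Gamma z * Gamma (1 - z)) * ((Digamma z - Digamma (1 - z)) * sin (of_real pi * z) + of_real pi * cos (of_real pi * z))"
  have "(?G has_field_derivative ?D) (at z)"
    using nonpos by (auto intro!: derivative_eq_intros simp: algebra_simps)
  moreover have "(?G has_field_derivative 0) (at z)"
    by (rule has_field_derivative_transform_within_open[OF _ open_nonint, of "\<lambda>_. of_real pi"])
       (use assms eq in auto)
  ultimately have "?D = 0" by (rule DERIV_unique)
  moreover have "Gamma z * Gamma (1 - z) \<noteq> 0"
    using nonpos by (simp add: Gamma_eq_zero_iff)
  ultimately have "(Digamma z - Digamma (1 - z)) * sin (of_real pi * z) + of_real pi * cos (of_real pi * z) = 0"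
    by (metis mult_eq_0_iff)
  thus ?thesis by (simp add: algebra_simps)
qed

text \<open>Induction on \<open>k\<close>: differentiating the power series termwise and multiplying
  by \<open>q\<close> adds one power of \<open>d\<close> and keeps convergence inside the unit
  disc.\<close>

lemma summable_power_times_geometric:
  fixes q :: "'a :: {real_normed_field, banach}"
  assumes "norm q < 1"
  shows "summable (\<lambda>d. of_nat d ^ k * q ^ d)"
  using assms
proof (induction k arbitrary: q)
  case (Suc k)
  have "summable (\<lambda>d. diffs (\<lambda>d. of_nat d ^ k) d * q ^ d)"
    by (rule termdiff_converges[of _ 1]) (use Suc in auto)
  hence "summable (\<lambda>d. diffs (\<lambda>d. of_nat d ^ k) d * q ^ d * q)"
    by (rule summable_mult2)
  hence "summable (\<lambda>d. of_nat (Suc d) ^ Suc k * q ^ Suc d)"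
    by (simp add: diffs_def mult_ac)
  thus ?case by (subst (asm) summable_Suc_iff)
qed (auto intro: summable_geometric)

text \<open>In the variable q = exp(2 pi i z), d/dz is 2 pi i q d/dq, so each derivative multiplies
  the d-th coefficient by 2 pi i d. This drives the induction in the next lemma.\<close>

lemma has_field_derivative_power_polylog:
  fixes z :: complex
  assumes "Im z > 0"
  shows "((\<lambda>z. \<Sum>d. of_nat d ^ k * exp (2 * of_real pi * \<i> * z) ^ d) has_field_derivative
           2 * of_real pi * \<i> * (\<Sum>d. of_nat d ^ Suc k * exp (2 * of_real pi * \<i> * z) ^ d)) (at z)"
proof -
  define q where "q = exp (2 * of_real pi * \<i> * z)"
  have q: "norm q < 1" using assms by (simp add: q_def)
  let ?c = "\<lambda>d. of_nat d ^ k :: complex"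
  have "((\<lambda>q. \<Sum>d. ?c d * q ^ d) has_field_derivative (\<Sum>d. diffs ?c d * q ^ d)) (at q)"
    by (rule termdiffs_strong'[of 1]) (use q summable_power_times_geometric[where 'a=complex] in auto)
  hence "((\<lambda>z. \<Sum>d. ?c d * exp (2 * of_real pi * \<i> * z) ^ d) has_field_derivative
      (\<Sum>d. diffs ?c d * q ^ d) * (q * (2 * of_real pi * \<i>))) (at z)"
    unfolding q_def by (rule DERIV_chain2) (auto intro!: derivative_eq_intros)
  moreover have "(\<Sum>d. diffs ?c d * q ^ d) * q = (\<Sum>d. of_nat d ^ Suc k * q ^ d)"
  proof -
    have sm: "summable (\<lambda>d. of_nat d ^ Suc k * q ^ d)"
      by (rule summable_power_times_geometric[OF q])
    have "summable (\<lambda>d. diffs ?c d * q ^ d)"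
      by (rule termdiff_converges[of _ 1]) (use q summable_power_times_geometric[where 'a=complex] in auto)
    hence "(\<Sum>d. diffs ?c d * q ^ d) * q = (\<Sum>d. diffs ?c d * q ^ d * q)"
      by (rule suminf_mult2)
    also have "\<dots> = (\<Sum>d. of_nat (Suc d) ^ Suc k * q ^ Suc d)"
      by (simp add: diffs_def algebra_simps)
    also have "\<dots> = (\<Sum>d. of_nat d ^ Suc k * q ^ d)"
      using suminf_split_head[OF sm] by simp
    finally show ?thesis .
  qed
  ultimately show ?thesis unfolding q_def by (simp add: mult_ac)
qed

text \<open>The case \<open>k = 0\<close> expands pi cot(pi z) as a geometric series in exp(2 pi i
  z); differentiation gives the rest. As 0^0 = 1, the sum for \<open>k = 0\<close> has a term at d =
  0, which is why the constant reads + pi i and not - pi i.\<close>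

lemma Polygamma_reflection_upper_half_plane:
  fixes z :: complex
  assumes "Im z > 0"
  shows "(-1) ^ k * Polygamma k (1 - z) - Polygamma k z =
     (if k = 0 then of_real pi * \<i> else 0) -
     (2 * of_real pi * \<i>) ^ Suc k * (\<Sum>d. of_nat d ^ k * exp (2 * of_real pi * \<i> * z) ^ d)"
  using assms
proof (induction k arbitrary: z)
  case (0 z)
  define q where "q = exp (2 * of_real pi * \<i> * z)"
  \<comment> \<open>\<open>w\<close> is a square root of \<open>q\<close>. Sine and cosine of pi z
    are Laurent polynomials in it, and multiplying by \<open>2 * \<i> * w\<close> clears the
    denominators.\<close>
  define w where "w = exp (of_real pi * \<i> * z)"
  have qw: "q = w^2" by (simp add: q_def w_def exp_double [symmetric] mult_ac)
  have q: "norm q < 1" using 0 by (simp add: q_def)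
  have q1: "1 - q \<noteq> 0" using q by auto
  have w: "w \<noteq> 0" by (simp add: w_def)
  have wi: "exp (- (of_real pi * \<i> * z)) = 1 / w" unfolding w_def by (simp only: exp_minus inverse_eq_divide)
  have s: "sin (of_real pi * z) = (w - 1 / w) / (2 * \<i>)"
    unfolding wi [symmetric] unfolding w_def sin_exp_eq by (simp add: mult_ac)
  have c: "cos (of_real pi * z) = (w + 1 / w) / 2"
    unfolding wi [symmetric] unfolding w_def cos_exp_eq by (simp add: mult_ac)
  have "z \<notin> \<int>" using 0 by (auto simp: complex_is_Int_iff)
  from Digamma_reflection[OF this]
  have "(Digamma (1 - z) - Digamma z) * ((w - 1 / w) / (2 * \<i>)) = of_real pi * ((w + 1 / w) / 2)"
    unfolding s c .
  hence "(Digamma (1 - z) - Digamma z) * (((w - 1 / w) / (2 * \<i>)) * (2 * \<i> * w)) =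
      of_real pi * (((w + 1 / w) / 2) * (2 * \<i> * w))"
    by (simp only: mult.assoc [symmetric])
  moreover have "((w - 1 / w) / (2 * \<i>)) * (2 * \<i> * w) = q - 1"
    using w by (simp add: qw field_simps power2_eq_square)
  moreover have "((w + 1 / w) / 2) * (2 * \<i> * w) = \<i> * (q + 1)"
    using w by (simp add: qw field_simps power2_eq_square)
  ultimately have *: "(Digamma (1 - z) - Digamma z) * (q - 1) = of_real pi * \<i> * (q + 1)"
    by (simp only: mult.assoc)
  have "(\<Sum>d. q ^ d) = 1 / (1 - q)" using q by (rule suminf_geometric)
  moreover have "Digamma (1 - z) - Digamma z = of_real pi * \<i> - 2 * of_real pi * \<i> * (1 / (1 - q))"
    using * q1 by (simp add: field_simps)
  ultimately show ?case by (simp add: q_def)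
next
  case (Suc k z)
  let ?L = "\<lambda>k z. \<Sum>d. of_nat d ^ k * exp (2 * of_real pi * \<i> * z) ^ d"
  let ?f = "\<lambda>z. (-1) ^ k * Polygamma k (1 - z) - Polygamma k z"
  let ?g = "\<lambda>z. (if k = 0 then of_real pi * \<i> else 0) - (2 * of_real pi * \<i>) ^ Suc k * ?L k z"
  have op: "open {z. Im z > 0}" by (simp add: open_halfspace_Im_gt)
  have np: "z \<notin> \<int>\<^sub>\<le>\<^sub>0" "1 - z \<notin> \<int>\<^sub>\<le>\<^sub>0"
    using Suc.prems by (auto elim!: nonpos_Ints_cases simp: complex_eq_iff)
  have df: "(?f has_field_derivative ((-1) ^ Suc k * Polygamma (Suc k) (1 - z) - Polygamma (Suc k) z)) (at z)"
    using np by (auto intro!: derivative_eq_intros DERIV_chain2[OF has_field_derivative_Polygamma])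
  have dg: "(?g has_field_derivative (0 - (2 * of_real pi * \<i>) ^ Suc k * (2 * of_real pi * \<i> * ?L (Suc k) z))) (at z)"
    by (intro DERIV_diff DERIV_const DERIV_cmult has_field_derivative_power_polylog Suc.prems)
  \<comment> \<open>The induction hypothesis holds on the whole open half-plane, so
    \<open>?f\<close> and \<open>?g\<close> coincide near \<open>z\<close> and share their
    derivative.\<close>
  have "(?f has_field_derivative (0 - (2 * of_real pi * \<i>) ^ Suc k * (2 * of_real pi * \<i> * ?L (Suc k) z))) (at z)"
    by (rule has_field_derivative_transform_within_open[OF dg op]) (use Suc in auto)
  from DERIV_unique[OF df this] show ?case by (simp add: mult_ac)
qed

text \<open>Up to sign and factorial, \<open>Polygamma k\<close> is the sum of (z + n)^-(k+1) over n
  >= 0. The arguments \<open>z\<close> and \<open>1 - z\<close> together cover all integer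
  translates of \<open>z\<close>, since the even exponent \<open>Suc k\<close> absorbs the sign of
  the negative ones.\<close>

lemma lipschitz_formula:
  fixes z :: complex
  assumes "Im z > 0" "odd k"
  shows "(\<lambda>n. inverse ((z + of_nat n) ^ Suc k) + inverse ((of_nat (Suc n) - z) ^ Suc k)) sums
     ((2 * of_real pi * \<i>) ^ Suc k / fact k * (\<Sum>d. of_nat d ^ k * exp (2 * of_real pi * \<i> * z) ^ d))"
proof -
  have k: "k > 0" "k \<noteq> 0" using assms by (auto intro!: Nat.gr0I)
  have nz: "z \<noteq> 0" "1 - z \<noteq> 0" using assms by (auto simp: complex_eq_iff)
  have "(\<lambda>n. inverse ((z + of_nat n) ^ Suc k) + inverse ((1 - z + of_nat n) ^ Suc k)) sums
     (((-1) ^ Suc k * Polygamma k z / fact k) + ((-1) ^ Suc k * Polygamma k (1 - z) / fact k))"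
    by (intro sums_add Polygamma_LIMSEQ nz k)
  also have "(((-1) ^ Suc k * Polygamma k z / fact k) + ((-1) ^ Suc k * Polygamma k (1 - z) / fact k)) =
      ((2 * of_real pi * \<i>) ^ Suc k / fact k * (\<Sum>d. of_nat d ^ k * exp (2 * of_real pi * \<i> * z) ^ d))"
  proof -
    have "(-1) ^ Suc k * Polygamma k z + (-1) ^ Suc k * Polygamma k (1 - z) = - ((-1) ^ k * Polygamma k (1 - z) - Polygamma k z)"
      using assms(2) by simp
    also have "\<dots> = (2 * of_real pi * \<i>) ^ Suc k * (\<Sum>d. of_nat d ^ k * exp (2 * of_real pi * \<i> * z) ^ d)"
      unfolding Polygamma_reflection_upper_half_plane[OF assms(1)] using k by simp
    finally show ?thesis
      unfolding times_divide_eq_left add_divide_distrib [symmetric] by (rule arg_cong)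
  qed
  finally show ?thesis by (simp add: algebra_simps)
qed

section \<open>Exchanging the summations in a lattice sum\<close>

lemma summable_on_prod_dominated:
  fixes f :: "nat \<Rightarrow> nat \<Rightarrow> 'a :: real_normed_vector"
  assumes "summable g" "summable h" "\<And>m n. norm (f m n) \<le> g m * h n" "\<And>n. h n \<ge> 0" "\<And>n. g n \<ge> 0"
  shows "(\<lambda>(m, n). norm (f m n)) summable_on UNIV"
proof -
  have "((\<lambda>n. h n) has_sum suminf h) UNIV"
    using assms by (intro sums_nonneg_imp_has_sum summable_sums) auto
  hence 1: "((\<lambda>n. g m * h n) has_sum g m * suminf h) UNIV" for m
    by (rule has_sum_cmult_right)
  have "((\<lambda>n. g n) has_sum suminf g) UNIV"
    using assms by (intro sums_nonneg_imp_has_sum summable_sums) auto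
  hence 2: "(\<lambda>m. g m * suminf h) summable_on UNIV"
    by (intro summable_on_cmult_left) (auto simp: summable_on_def)
  have "(\<lambda>(m, n). g m * h n) summable_on Sigma UNIV (\<lambda>_. UNIV)"
    by (rule summable_on_SigmaI[OF _ 2]) (use 1 assms in auto)
  hence "(\<lambda>(m, n). g m * h n) summable_on UNIV" by simp
  hence "(\<lambda>x. norm (case x of (m, n) \<Rightarrow> f m n)) summable_on UNIV"
    by (intro Infinite_Sum.abs_summable_on_comparison_test'[where g = "\<lambda>(m, n). g m * h n"]) (use assms in auto)
  thus ?thesis by (simp add: case_prod_unfold)
qed

lemma iterated_sums_infsum:
  fixes f :: "nat \<Rightarrow> nat \<Rightarrow> 'a :: banach"
  assumes "(\<lambda>(m, n). norm (f m n)) summable_on UNIV"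
  shows "summable (\<lambda>n. norm (f m n))" "(\<lambda>m. \<Sum>n. f m n) sums infsum (\<lambda>(m, n). f m n) UNIV"
proof -
  have norm_row: "summable (\<lambda>n. norm (f m n))" for m
  proof -
    have "(\<lambda>n. norm (f m n)) summable_on UNIV"
      using summable_on_SigmaD1[of "\<lambda>m n. norm (f m n)" UNIV "\<lambda>_. UNIV" m] assms by simp
    thus ?thesis by (rule summable_on_imp_summable)
  qed
  show "summable (\<lambda>n. norm (f m n))" by (rule norm_row)
  have row: "((\<lambda>n. f m n) has_sum (\<Sum>n. f m n)) UNIV" for m
    by (intro norm_summable_imp_has_sum norm_row summable_sums summable_norm_cancel)
  have "(\<lambda>(m, n). f m n) summable_on UNIV"
    by (rule abs_summable_summable) (use assms in \<open>simp add: case_prod_unfold\<close>)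
  hence "((\<lambda>(m, n). f m n) has_sum infsum (\<lambda>(m, n). f m n) UNIV) (Sigma UNIV (\<lambda>_. UNIV))"
    by simp
  from has_sum_SigmaD[OF this, of "\<lambda>m. \<Sum>n. f m n"] row
  show "(\<lambda>m. \<Sum>n. f m n) sums infsum (\<lambda>(m, n). f m n) UNIV"
    by (intro has_sum_imp_sums) simp
qed

lemma infsum_prod_swap:
  fixes f :: "nat \<Rightarrow> nat \<Rightarrow> 'a :: banach"
  assumes "(\<lambda>(m, n). norm (f m n)) summable_on UNIV"
  shows "(\<lambda>(n, m). norm (f m n)) summable_on UNIV"
    "infsum (\<lambda>(n, m). f m n) UNIV = infsum (\<lambda>(m, n). f m n) UNIV"
proof -
  show "(\<lambda>(n, m). norm (f m n)) summable_on UNIV"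
    using summable_on_swap[of "\<lambda>(m, n). norm (f m n)" UNIV UNIV] assms by simp
  have "(\<lambda>(m, n). f m n) summable_on UNIV"
    by (rule abs_summable_summable) (use assms in \<open>simp add: case_prod_unfold\<close>)
  hence "((\<lambda>(m, n). f m n) has_sum infsum (\<lambda>(m, n). f m n) UNIV) (UNIV \<times> UNIV)"
    by simp
  hence "((\<lambda>(n, m). f m n) has_sum infsum (\<lambda>(m, n). f m n) UNIV) (UNIV \<times> UNIV)"
    by (subst (asm) has_sum_swap) (simp add: case_prod_unfold)
  thus "infsum (\<lambda>(n, m). f m n) UNIV = infsum (\<lambda>(m, n). f m n) UNIV"
    by (simp add: infsumI)
qed

section \<open>Absolute convergence of lattice sums\<close>

lemma summable_shifted_powr:
  assumes "s > 1" "\<alpha> > 0"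
  shows "summable (\<lambda>n. (real n + \<alpha>) powr (- s))"
proof -
  \<comment> \<open>This constant gives c (n + 1) <= n + \<alpha>, a comparison with the p-series
    that also covers shifts below 1.\<close>
  define c where "c = min 1 \<alpha>"
  have c: "0 < c" "c \<le> 1" "c \<le> \<alpha>" using assms by (auto simp: c_def)
  have "summable (\<lambda>n. real n powr (- s))"
    using assms by (simp add: summable_real_powr_iff)
  hence "summable (\<lambda>n. real (Suc n) powr (- s))"
    by (subst summable_Suc_iff)
  hence "summable (\<lambda>n. c powr (- s) * real (Suc n) powr (- s))"
    by (rule summable_mult)
  thus ?thesis
  proof (rule summable_comparison_test'[where N = 0])
    fix n :: nat
    have "c * real n \<le> 1 * real n" using c by (intro mult_right_mono) auto
    hence "c * real (Suc n) \<le> real n + \<alpha>" using c by (simp add: algebra_simps)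
    hence "(real n + \<alpha>) powr (- s) \<le> (c * real (Suc n)) powr (- s)"
      using assms c by (intro powr_mono2') auto
    also have "\<dots> = c powr (- s) * real (Suc n) powr (- s)"
      using c by (subst powr_mult) auto
    finally show "norm ((real n + \<alpha>) powr (- s)) \<le> c powr (- s) * real (Suc n) powr (- s)" by simp
  qed
qed

text \<open>Both coordinates are real parameters because row sums fix \<open>t\<close> and run
  through u = n + \<theta> and n + 1 - \<theta>, while column sums fix \<open>u\<close> and run
  through integer \<open>t\<close>. Only u > 0 enters the sums: points below the real axis are
  conjugates of these and have the same real parts of powers.\<close>

definition lattice_point :: "real \<Rightarrow> real \<Rightarrow> real \<Rightarrow> complex" where
  "lattice_point y t u = Complex (t * y) (2 * pi * u)"

text \<open>By the inequality of arithmetic and geometric means, |t y + 2 pi i u|^2 >= 4 pi y t u.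
  This separates the two variables at the price of halving the exponent.\<close>

lemma lattice_point_inverse_power_bound:
  assumes "y > 0" "t > 0" "u > 0"
  shows "inverse (norm (lattice_point y t u)) ^ q \<le>
    (4 * pi * y) powr (- (real q / 2)) * (t powr (- (real q / 2)) * u powr (- (real q / 2)))"
proof -
  define w where "w = 4 * pi * y * (t * u)"
  have w: "w > 0" using assms by (simp add: w_def)
  have "0 \<le> (t * y - 2 * pi * u) ^ 2" by simp
  hence "w \<le> (t * y) ^ 2 + (2 * pi * u) ^ 2"
    by (simp add: w_def power2_eq_square algebra_simps)
  hence "w \<le> (norm (lattice_point y t u)) ^ 2"
    by (simp add: lattice_point_def cmod_power2)
  hence "w powr (1/2) \<le> ((norm (lattice_point y t u)) ^ 2) powr (1/2)"
    using w by (intro powr_mono2) auto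
  hence *: "w powr (1/2) \<le> norm (lattice_point y t u)"
    by (simp add: powr_half_sqrt)
  have "inverse (norm (lattice_point y t u)) ^ q \<le> inverse (w powr (1/2)) ^ q"
    using * w by (intro power_mono le_imp_inverse_le) auto
  also have "\<dots> = w powr (- (real q / 2))"
    using w by (simp add: powr_minus [symmetric] powr_realpow [symmetric] powr_powr)
  also have "\<dots> = (4 * pi * y) powr (- (real q / 2)) * (t powr (- (real q / 2)) * u powr (- (real q / 2)))"
    using assms unfolding w_def by (subst powr_mult, simp, simp, subst powr_mult) auto
  finally show ?thesis .
qed

text \<open>After the separation each variable decays with exponent q / 2, which exceeds 1 once
  \<open>q \<ge> 3\<close>. Exponent 2 is the borderline and gets an argument of its own
  below.\<close>

lemma lattice_summable_on:
  fixes f :: "nat \<Rightarrow> nat \<Rightarrow> real"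
  assumes "y > 0" "\<alpha> > 0" "q \<ge> 3"
    and "\<And>m n. \<bar>f m n\<bar> \<le> C * inverse (norm (lattice_point y (real (Suc m)) (real n + \<alpha>))) ^ q"
    and "C \<ge> 0"
  shows "(\<lambda>(m, n). norm (f m n)) summable_on UNIV"
proof (rule summable_on_prod_dominated)
  let ?s = "real q / 2"
  show "summable (\<lambda>m. C * (4 * pi * y) powr (- ?s) * (real m + 1) powr (- ?s))"
    using assms by (intro summable_mult summable_shifted_powr) auto
  show "summable (\<lambda>n. (real n + \<alpha>) powr (- ?s))"
    using assms by (intro summable_shifted_powr) auto
  fix m n
  have "norm (f m n) \<le> C * inverse (norm (lattice_point y (real (Suc m)) (real n + \<alpha>))) ^ q"
    using assms(4)[of m n] by simp
  also have "\<dots> \<le> C * ((4 * pi * y) powr (- ?s) * ((real (Suc m)) powr (- ?s) * (real n + \<alpha>) powr (- ?s)))"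
    using assms by (intro mult_left_mono lattice_point_inverse_power_bound) auto
  finally show "norm (f m n) \<le> C * (4 * pi * y) powr (- ?s) * (real m + 1) powr (- ?s) * (real n + \<alpha>) powr (- ?s)"
    by (simp add: mult_ac add_ac)
qed (use assms in auto)

lemma Im_inverse_lattice_point:
  "Im (inverse (lattice_point y t u)) = - (2 * pi * (u / ((t * y)^2 + (2 * pi * u)^2)))"
  by (simp add: lattice_point_def)

text \<open>Sandwiches a Riemann sum of \<open>u / ((t y)\<^sup>2 + (2 \<pi> u)\<^sup>2)\<close> between increments of its antiderivative in \<open>t\<close>.\<close>
lemma lattice_kernel_sums_tendsto:
  assumes "y > 0"
  shows "u > 0 \<Longrightarrow> summable (\<lambda>m. u / ((real (Suc m) * y)^2 + (2 * pi * u)^2))"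
    and "((\<lambda>u. \<Sum>m. u / ((real (Suc m) * y)^2 + (2 * pi * u)^2)) \<longlongrightarrow> 1 / (4 * y)) at_top"
proof -
  define F where "F = (\<lambda>u t. arctan (t * y / (2 * pi * u)) / (2 * pi * y))"
  define e where "e = (\<lambda>u t. u / ((t * y)^2 + (2 * pi * u)^2))"
  have F': "((\<lambda>t. F u t) has_real_derivative e u t) (at t)" if "u > 0" for u t
  proof -
    have "((\<lambda>t. t * y / (2 * pi * u)) has_real_derivative y / (2 * pi * u)) (at t)"
      by (rule DERIV_cdivide) (auto intro!: derivative_eq_intros)
    from DERIV_cdivide[OF DERIV_chain2[OF DERIV_arctan this]]
    have "((\<lambda>t. F u t) has_real_derivative
      inverse (1 + (t * y / (2 * pi * u))^2) * (y / (2 * pi * u)) / (2 * pi * y)) (at t)"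
      unfolding F_def .
    also have "inverse (1 + (t * y / (2 * pi * u))^2) * (y / (2 * pi * u)) / (2 * pi * y) = e u t"
    proof -
      define N where "N = (t * y)^2 + (2 * pi * u)^2"
      have "1 + (t * y / (2 * pi * u))^2 = N / (2 * pi * u)^2"
        using that by (simp add: N_def power_divide add_divide_distrib)
      hence "inverse (1 + (t * y / (2 * pi * u))^2) * (y / (2 * pi * u)) / (2 * pi * y) =
          inverse (N / (2 * pi * u)^2) * (y / (2 * pi * u)) / (2 * pi * y)"
        by (simp only:)
      also have "\<dots> = u / N"
        using that assms by (simp add: power2_eq_square)
      finally show ?thesis by (simp add: e_def N_def)
    qed
    finally show ?thesis .
  qed
  have e_mono: "e u t \<le> e u s" if "u > 0" "0 \<le> s" "s \<le> t" for u s t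
    using that assms unfolding e_def
    by (intro divide_left_mono add_mono power_mono mult_right_mono add_nonneg_pos mult_pos_pos) auto
  have e_nonneg: "e u t \<ge> 0" if "u > 0" for u t using that by (simp add: e_def)
  have mvt: "\<exists>s. real m < s \<and> s < real (Suc m) \<and> F u (real (Suc m)) - F u (real m) = e u s" if "u > 0" for u m
    using MVT2[of "real m" "real (Suc m)" "F u" "e u"] F'[OF that] by auto
  have upper: "e u (real (Suc m)) \<le> F u (real (Suc m)) - F u (real m)" if "u > 0" for u m
    using mvt[OF that, of m] e_mono[OF that] by (metis less_imp_le of_nat_0_le_iff order_trans)
  have lower: "F u (real (Suc m)) - F u (real m) \<le> e u (real m)" if "u > 0" for u m
    using mvt[OF that, of m] e_mono[OF that] by (metis less_imp_le of_nat_0_le_iff)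
  have F_lim: "(\<lambda>m. F u (real m)) \<longlonglongrightarrow> 1 / (4 * y)" if "u > 0" for u
  proof -
    have "filterlim (\<lambda>m. real m * (y / (2 * pi * u))) at_top sequentially"
      using that assms by (intro filterlim_at_top_mult_tendsto_pos[OF tendsto_const] filterlim_real_sequentially) auto
    hence "(\<lambda>m. arctan (real m * (y / (2 * pi * u)))) \<longlonglongrightarrow> pi / 2"
      by (rule filterlim_compose[OF tendsto_arctan_at_top])
    hence "(\<lambda>m. arctan (real m * (y / (2 * pi * u))) / (2 * pi * y)) \<longlonglongrightarrow> pi / 2 / (2 * pi * y)"
      by (intro tendsto_divide tendsto_const) (use assms in auto)
    thus ?thesis unfolding F_def by simp
  qed
  \<comment> \<open>Since \<open>e\<close> decreases in \<open>t\<close>, the sum over m >= 1 lies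
    below the integral over (0, infinity) and above the one over (1, infinity). The two telescoped
    bounds differ by \<open>F u 1\<close>, which tends to 0 as \<open>u\<close> grows.\<close>
  have t0: "(\<lambda>m. F u (real (Suc m)) - F u (real m)) sums (1 / (4 * y) - F u 0)" if "u > 0" for u
    using telescope_sums[OF F_lim[OF that]] by simp
  have t1: "(\<lambda>m. F u (real (Suc (Suc m))) - F u (real (Suc m))) sums (1 / (4 * y) - F u 1)" if "u > 0" for u
    using telescope_sums[OF LIMSEQ_Suc[OF F_lim[OF that]]] by simp
  have sm: "summable (\<lambda>m. e u (real (Suc m)))" if "u > 0" for u
    by (rule summable_comparison_test'[OF sums_summable[OF t0[OF that]], of 0])
       (use upper[OF that] e_nonneg[OF that] in auto)
  thus "u > 0 \<Longrightarrow> summable (\<lambda>m. u / ((real (Suc m) * y)^2 + (2 * pi * u)^2))"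
    by (simp add: e_def)
  have up: "(\<Sum>m. e u (real (Suc m))) \<le> 1 / (4 * y)" if "u > 0" for u
  proof -
    have "(\<Sum>m. e u (real (Suc m))) \<le> 1 / (4 * y) - F u 0"
      using suminf_le[OF upper[OF that] sm[OF that] sums_summable[OF t0[OF that]]] sums_unique[OF t0[OF that]] by simp
    thus ?thesis by (simp add: F_def)
  qed
  have lo: "1 / (4 * y) - F u 1 \<le> (\<Sum>m. e u (real (Suc m)))" if "u > 0" for u
    using suminf_le[OF lower[OF that] sums_summable[OF t1[OF that]] sm[OF that]] sums_unique[OF t1[OF that]] by simp
  have inv: "((\<lambda>u::real. inverse u) \<longlongrightarrow> 0) at_top"
    by (rule tendsto_inverse_0_at_top[OF filterlim_ident])
  have "(\<lambda>u. y / (2 * pi * u)) = (\<lambda>u. (y / (2 * pi)) * inverse u)"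
    by (rule ext) (simp add: field_simps)
  hence "((\<lambda>u. y / (2 * pi * u)) \<longlongrightarrow> 0) at_top"
    by (simp only: tendsto_mult_right_zero[OF inv])
  from tendsto_arctan[OF this]
  have "((\<lambda>u. arctan (y / (2 * pi * u))) \<longlongrightarrow> 0) at_top" by simp
  hence "((\<lambda>u. arctan (y / (2 * pi * u)) / (2 * pi * y)) \<longlongrightarrow> 0) at_top"
    by (rule tendsto_divide_zero)
  hence F1: "((\<lambda>u. F u 1) \<longlongrightarrow> 0) at_top"
    unfolding F_def by simp
  have F2: "((\<lambda>u. 1 / (4 * y) - F u 1) \<longlongrightarrow> 1 / (4 * y)) at_top"
    using tendsto_diff[OF tendsto_const F1] by simp
  have "((\<lambda>u. \<Sum>m. e u (real (Suc m))) \<longlongrightarrow> 1 / (4 * y)) at_top"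
  proof (rule tendsto_sandwich[OF _ _ F2 tendsto_const])
    show "\<forall>\<^sub>F u in at_top. 1 / (4 * y) - F u 1 \<le> (\<Sum>m. e u (real (Suc m)))"
      using eventually_gt_at_top[of 0] by eventually_elim (rule lo)
    show "\<forall>\<^sub>F u in at_top. (\<Sum>m. e u (real (Suc m))) \<le> 1 / (4 * y)"
      using eventually_gt_at_top[of 0] by eventually_elim (rule up)
  qed
  thus "((\<lambda>u. \<Sum>m. u / ((real (Suc m) * y)^2 + (2 * pi * u)^2)) \<longlongrightarrow> 1 / (4 * y)) at_top"
    by (simp add: e_def)
qed

text \<open>The first identity makes the product term a telescoping difference. The second says that
  replacing an inverse square by it costs only a term of cubic decay, which is within reach of
  \<open>lattice_summable_on\<close>.\<close>

lemma inverse_mult_shift: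
  fixes z w c :: "'a :: field"
  assumes "z \<noteq> 0" "w \<noteq> 0" "c \<noteq> 0" "w = z + c"
  shows "inverse (z * w) = (inverse z - inverse w) / c"
    and "inverse z ^ 2 - inverse (z * w) = c * (inverse z ^ 2 * inverse w)"
proof -
  have *: "inverse z - inverse w = c * (inverse z * inverse w)"
    using division_ring_inverse_diff[OF assms(1,2)] assms(4) by (simp add: mult_ac)
  show "inverse (z * w) = (inverse z - inverse w) / c"
    unfolding * using assms(3) by simp
  have "inverse z ^ 2 - inverse (z * w) = inverse z * (inverse z - inverse w)"
    by (simp add: power2_eq_square algebra_simps)
  thus "inverse z ^ 2 - inverse (z * w) = c * (inverse z ^ 2 * inverse w)"
    unfolding * by (simp add: power2_eq_square mult_ac)
qed

text \<open>For \<open>p \<ge> 3\<close> the two iterated sums agree by absolute convergence. For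
  \<open>p = 2\<close> summing columns first gives 1 / (4 y) more than summing rows first. The row
  total \<open>S\<close> stays existential here; it is identified later from the column
  sums.\<close>

lemma lattice_sum_swap:
  assumes y: "y > 0" and al: "\<alpha> > 0" and p: "p \<ge> 2"
  defines "W \<equiv> (\<lambda>m n. Re (inverse (lattice_point y (real (Suc m)) (real n + \<alpha>)) ^ p))"
  shows "summable (W m)" "summable (\<lambda>m. W m n)"
    "\<exists>S. (\<lambda>m. \<Sum>n. W m n) sums S \<and>
         (\<lambda>n. \<Sum>m. W m n) sums (S + (if p = 2 then 1 / (4 * y) else 0))"
proof -
  let ?z = "\<lambda>m n. lattice_point y (real (Suc m)) (real n + \<alpha>)"
  \<comment> \<open>An elimination rule, because it serves twice: for \<open>W\<close> when
    \<open>p > 2\<close> and for the corrected terms \<open>D\<close> when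
    \<open>p = 2\<close>.\<close>
  have abs_conv: thesis if "(\<lambda>(m, n). norm (f m n)) summable_on UNIV"
     "(\<And>S. (\<And>m. summable (f m)) \<Longrightarrow> (\<And>n. summable (\<lambda>m. f m n)) \<Longrightarrow> (\<lambda>m. \<Sum>n. f m n) sums S \<Longrightarrow> (\<lambda>n. \<Sum>m. f m n) sums S \<Longrightarrow> thesis)"
     for f :: "nat \<Rightarrow> nat \<Rightarrow> real" and thesis
  proof (rule that(2))
    show "summable (f m)" for m
      using iterated_sums_infsum(1)[OF that(1), of m] by (rule summable_norm_cancel)
    show "summable (\<lambda>m. f m n)" for n
      using iterated_sums_infsum(1)[OF infsum_prod_swap(1)[OF that(1)], of n] by (rule summable_norm_cancel)
    show "(\<lambda>m. \<Sum>n. f m n) sums infsum (\<lambda>(m, n). f m n) UNIV"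
      by (rule iterated_sums_infsum(2)[OF that(1)])
    show "(\<lambda>n. \<Sum>m. f m n) sums infsum (\<lambda>(m, n). f m n) UNIV"
      using iterated_sums_infsum(2)[OF infsum_prod_swap(1)[OF that(1)]] infsum_prod_swap(2)[OF that(1)] by simp
  qed
  have "(\<forall>m. summable (W m)) \<and> (\<forall>n. summable (\<lambda>m. W m n)) \<and>
    (\<exists>S. (\<lambda>m. \<Sum>n. W m n) sums S \<and> (\<lambda>n. \<Sum>m. W m n) sums (S + (if p = 2 then 1 / (4 * y) else 0)))"
  proof (cases "p = 2")
    case False
    have "\<bar>W m n\<bar> \<le> 1 * inverse (norm (?z m n)) ^ p" for m n
      unfolding W_def using abs_Re_le_cmod by (metis mult_1 norm_inverse norm_power)
    from lattice_summable_on[OF y al _ this] False p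
    have "(\<lambda>(m, n). norm (W m n)) summable_on UNIV" by simp
    thus ?thesis by (rule abs_conv) (use False in auto)
  next
    case True
    define e where "e = (\<lambda>m n. (real n + \<alpha>) / ((real (Suc m) * y)^2 + (2 * pi * (real n + \<alpha>))^2))"
    define T where "T = (\<lambda>m n. Re (inverse (?z m n * ?z m (Suc n))))"
    define H where "H = (\<lambda>n. \<Sum>m. e m n)"
    have znz: "?z m n \<noteq> 0" for m n using y by (simp add: lattice_point_def complex_eq_iff)
    have step: "?z m (Suc n) = ?z m n + 2 * of_real pi * \<i>" for m n
      by (simp add: lattice_point_def complex_eq_iff algebra_simps)
    have Re_div: "Re (w / (2 * of_real pi * \<i>)) = Im w / (2 * pi)" for w
      by (simp add: Re_divide power2_eq_square)
    have T_eq: "T m n = e m (Suc n) - e m n" for m n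
    proof -
      have "inverse (?z m n * ?z m (Suc n)) = (inverse (?z m n) - inverse (?z m (Suc n))) / (2 * of_real pi * \<i>)"
        by (rule inverse_mult_shift(1)[OF znz znz _ step]) simp
      hence "T m n = (Im (inverse (?z m n)) - Im (inverse (?z m (Suc n)))) / (2 * pi)"
        unfolding T_def by (simp only: Re_div minus_complex.sel)
      also have "\<dots> = (- (2 * pi * e m n) - - (2 * pi * e m (Suc n))) / (2 * pi)"
        by (simp only: Im_inverse_lattice_point e_def)
      also have "\<dots> = e m (Suc n) - e m n"
        by (simp add: diff_divide_distrib)
      finally show ?thesis .
    qed
    \<comment> \<open>For exponent 2 the double series is only conditionally convergent. Subtracting the telescoping
      comparison terms \<open>T\<close> makes it absolutely convergent; all of the defect sits in the two
      iterated sums of \<open>T\<close>.\<close>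
    define D where "D = (\<lambda>m n. W m n - T m n)"
    have "\<bar>D m n\<bar> \<le> (2 * pi) * inverse (norm (?z m n)) ^ 3" for m n
    proof -
      \<comment> \<open>This monotonicity turns the mixed product left by the subtraction into an
        inverse cube at the single point \<open>?z m n\<close>.\<close>
      have "norm (?z m n) \<le> norm (?z m (Suc n))"
        using al y unfolding lattice_point_def cmod_def
        by (intro real_sqrt_le_mono add_mono power_mono) auto
      hence le: "inverse (norm (?z m (Suc n))) \<le> inverse (norm (?z m n))"
        using znz by (intro le_imp_inverse_le) auto
      have "D m n = Re (inverse (?z m n) ^ 2 - inverse (?z m n * ?z m (Suc n)))"
        by (simp add: D_def W_def T_def True)
      hence "\<bar>D m n\<bar> \<le> norm (inverse (?z m n) ^ 2 - inverse (?z m n * ?z m (Suc n)))"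
        by (simp only: abs_Re_le_cmod)
      also have "inverse (?z m n) ^ 2 - inverse (?z m n * ?z m (Suc n)) = (2 * of_real pi * \<i>) * (inverse (?z m n) ^ 2 * inverse (?z m (Suc n)))"
        by (rule inverse_mult_shift(2)[OF znz znz _ step]) simp
      also have "norm \<dots> = (2 * pi) * (inverse (norm (?z m n)) ^ 2 * inverse (norm (?z m (Suc n))))"
        by (simp add: norm_mult norm_inverse norm_power)
      also have "\<dots> \<le> (2 * pi) * (inverse (norm (?z m n)) ^ 2 * inverse (norm (?z m n)))"
        by (intro mult_left_mono le) auto
      finally show ?thesis by (simp add: power3_eq_cube power2_eq_square mult_ac)
    qed
    from lattice_summable_on[OF y al _ this]
    have "(\<lambda>(m, n). norm (D m n)) summable_on UNIV" by simp
    then obtain S where S: "\<And>m. summable (D m)" "\<And>n. summable (\<lambda>m. D m n)"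
      "(\<lambda>m. \<Sum>n. D m n) sums S" "(\<lambda>n. \<Sum>m. D m n) sums S"
      using abs_conv[of D] by metis
    have e_summable: "summable (\<lambda>m. e m n)" for n
      unfolding e_def using lattice_kernel_sums_tendsto(1)[OF y, of "real n + \<alpha>"] al by simp
    have u_lim: "filterlim (\<lambda>n. real n + \<alpha>) at_top sequentially"
      using filterlim_tendsto_add_at_top[OF tendsto_const filterlim_real_sequentially, of \<alpha>]
      by (simp add: add.commute)
    have H_lim: "H \<longlonglongrightarrow> 1 / (4 * y)"
      unfolding H_def e_def by (rule filterlim_compose[OF lattice_kernel_sums_tendsto(2)[OF y] u_lim])
    have e_lim: "(\<lambda>n. e m n) \<longlonglongrightarrow> 0" for m
    proof (rule tendsto_sandwich[OF _ _ tendsto_const])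
      have "((\<lambda>n. 1 / (real n + \<alpha>)) \<longlongrightarrow> 0) sequentially"
        by (intro tendsto_divide_0[OF tendsto_const] filterlim_at_top_imp_at_infinity u_lim)
      thus "((\<lambda>n. (1 / (2 * pi)^2) * (1 / (real n + \<alpha>))) \<longlongrightarrow> 0) sequentially"
        by (rule tendsto_mult_right_zero)
      show "\<forall>\<^sub>F n in sequentially. 0 \<le> e m n" using al by (intro always_eventually) (simp add: e_def)
      show "\<forall>\<^sub>F n in sequentially. e m n \<le> (1 / (2 * pi)^2) * (1 / (real n + \<alpha>))"
      proof (intro always_eventually allI)
        fix n
        have "e m n \<le> (real n + \<alpha>) / (2 * pi * (real n + \<alpha>))^2"
          unfolding e_def using al by (intro divide_left_mono mult_pos_pos add_nonneg_pos) auto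
        also have "\<dots> = (1 / (2 * pi)^2) * (1 / (real n + \<alpha>))"
          using al by (simp add: power_mult_distrib power2_eq_square)
        finally show "e m n \<le> (1 / (2 * pi)^2) * (1 / (real n + \<alpha>))" .
      qed
    qed
    \<comment> \<open>Along a row \<open>T\<close> telescopes with limit 0, and the rows add up to
      \<open>- H 0\<close>. The column sums telescope in \<open>H\<close>, whose limit is 1 / (4 y)
      rather than 0. This difference is the whole defect.\<close>
    have T_row: "T m sums (- e m 0)" for m
      using telescope_sums[OF e_lim[of m]] unfolding T_eq [symmetric] by simp
    have T_col: "(\<lambda>m. T m n) sums (H (Suc n) - H n)" for n
      unfolding T_eq H_def by (intro sums_diff summable_sums e_summable)
    have H_tel: "(\<lambda>n. H (Suc n) - H n) sums (1 / (4 * y) - H 0)"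
      by (rule telescope_sums[OF H_lim])
    have T_rows: "(\<lambda>m. - e m 0) sums (- H 0)"
      unfolding H_def by (intro sums_minus summable_sums e_summable)
    have W_eq: "W = (\<lambda>m n. D m n + T m n)" by (simp add: D_def)
    have row: "W m sums ((\<Sum>n. D m n) - e m 0)" for m
      using sums_add[OF summable_sums[OF S(1)[of m]] T_row[of m]] by (simp add: W_eq)
    have col: "(\<lambda>m. W m n) sums ((\<Sum>m. D m n) + (H (Suc n) - H n))" for n
      using sums_add[OF summable_sums[OF S(2)[of n]] T_col[of n]] by (simp add: W_eq)
    have 1: "(\<lambda>m. \<Sum>n. W m n) sums (S - H 0)"
      using sums_add[OF S(3) T_rows] sums_unique[OF row, symmetric] by simp
    have 2: "(\<lambda>n. \<Sum>m. W m n) sums (S + (1 / (4 * y) - H 0))"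
      using sums_add[OF S(4) H_tel] sums_unique[OF col, symmetric] by simp
    show ?thesis
      by (intro conjI allI sums_summable[OF row] sums_summable[OF col] exI[of _ "S - H 0"] 1)
         (use 2 True in \<open>simp add: algebra_simps\<close>)
  qed
  thus "summable (W m)" "summable (\<lambda>m. W m n)"
    "\<exists>S. (\<lambda>m. \<Sum>n. W m n) sums S \<and>
         (\<lambda>n. \<Sum>m. W m n) sums (S + (if p = 2 then 1 / (4 * y) else 0))" by blast+
qed

section \<open>Transformation of the twisted divisor series\<close>

lemma neg_one_power_half_even:
  assumes "even p"
  shows "(c * \<i>) ^ p = of_real ((-1) ^ (p div 2)) * c ^ p"
  using assms by (elim evenE) (simp add: power_mult power_mult_distrib power_minus[of "c\<^sup>2"])

lemma inverse_power_scale: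
  fixes a b c :: "'a :: field"
  shows "inverse (c ^ p) * (inverse (a ^ p) + inverse (b ^ p)) = inverse (c * a) ^ p + inverse (c * b) ^ p"
  by (simp add: power_mult_distrib power_inverse distrib_left)

text \<open>Lipschitz' formula at the point with 2 pi i z = - t y + 2 pi i \<theta>. The translates
  z + n give negated conjugates of lattice points, the others give lattice points; the even exponent
  removes the sign and the real part removes the conjugation.\<close>

lemma lattice_row_sums:
  assumes y: "y > 0" and t: "t > 0" and th: "0 < \<theta>" "\<theta> < 1" and k: "odd k"
  shows "(\<lambda>n. fact k * (Re (inverse (lattice_point y t (real n + \<theta>)) ^ Suc k) +
                        Re (inverse (lattice_point y t (real n + (1 - \<theta>))) ^ Suc k)))
     sums (\<Sum>d. real d ^ k * cos (2 * pi * real d * \<theta>) * exp (- (real d * t * y)))"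
proof -
  define z where "z = Complex \<theta> (t * y / (2 * pi))"
  have ev: "even (Suc k)" using k by simp
  have Imz: "Im z > 0" using y t by (simp add: z_def)
  have q: "exp (2 * of_real pi * \<i> * z) ^ d = of_real (exp (- (real d * t * y))) * cis (2 * pi * real d * \<theta>)" for d
  proof -
    have "exp (2 * of_real pi * \<i> * z) ^ d = exp (of_nat d * (2 * of_real pi * \<i> * z))"
      by (simp add: exp_of_nat_mult)
    also have "of_nat d * (2 * of_real pi * \<i> * z) = of_real (- (real d * t * y)) + \<i> * of_real (2 * pi * real d * \<theta>)"
      by (simp add: z_def complex_eq_iff)
    also have "exp \<dots> = of_real (exp (- (real d * t * y))) * cis (2 * pi * real d * \<theta>)"
      by (simp only: exp_add exp_of_real cis_conv_exp)
    finally show ?thesis .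
  qed
  have sm: "summable (\<lambda>d. of_nat d ^ k * exp (2 * of_real pi * \<i> * z) ^ d)"
    by (rule summable_power_times_geometric) (use Imz in simp)
  have cz: "(2 * of_real pi * \<i>) ^ Suc k \<noteq> 0" by simp
  have "(\<lambda>n. fact k / (2 * of_real pi * \<i>) ^ Suc k * (inverse ((z + of_nat n) ^ Suc k) + inverse ((of_nat (Suc n) - z) ^ Suc k)))
     sums (fact k / (2 * of_real pi * \<i>) ^ Suc k * ((2 * of_real pi * \<i>) ^ Suc k / fact k * (\<Sum>d. of_nat d ^ k * exp (2 * of_real pi * \<i> * z) ^ d)))"
    by (intro sums_mult lipschitz_formula Imz k)
  also have "fact k / (2 * of_real pi * \<i>) ^ Suc k * ((2 * of_real pi * \<i>) ^ Suc k / fact k * (\<Sum>d. of_nat d ^ k * exp (2 * of_real pi * \<i> * z) ^ d))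
     = (\<Sum>d. of_nat d ^ k * exp (2 * of_real pi * \<i> * z) ^ d)"
    using cz by (simp del: power_Suc)
  finally have "(\<lambda>n. Re (fact k / (2 * of_real pi * \<i>) ^ Suc k * (inverse ((z + of_nat n) ^ Suc k) + inverse ((of_nat (Suc n) - z) ^ Suc k))))
     sums Re (\<Sum>d. of_nat d ^ k * exp (2 * of_real pi * \<i> * z) ^ d)"
    by (rule sums_Re)
  also have "Re (\<Sum>d. of_nat d ^ k * exp (2 * of_real pi * \<i> * z) ^ d) = (\<Sum>d. Re (of_nat d ^ k * exp (2 * of_real pi * \<i> * z) ^ d))"
    using sums_Re[OF summable_sums[OF sm]] by (rule sums_unique)
  also have "(\<lambda>d. Re (of_nat d ^ k * exp (2 * of_real pi * \<i> * z) ^ d)) = (\<lambda>d. real d ^ k * cos (2 * pi * real d * \<theta>) * exp (- (real d * t * y)))"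
  proof
    fix d
    have "of_nat d ^ k * exp (2 * of_real pi * \<i> * z) ^ d = of_real (real d ^ k * exp (- (real d * t * y))) * cis (2 * pi * real d * \<theta>)"
      unfolding q by simp
    moreover have "Re (of_real A * cis B) = A * cos B" for A B by simp
    ultimately show "Re (of_nat d ^ k * exp (2 * of_real pi * \<i> * z) ^ d) = real d ^ k * cos (2 * pi * real d * \<theta>) * exp (- (real d * t * y))"
      by (simp only: mult_ac)
  qed
  also have "(\<lambda>n. Re (fact k / (2 * of_real pi * \<i>) ^ Suc k * (inverse ((z + of_nat n) ^ Suc k) + inverse ((of_nat (Suc n) - z) ^ Suc k))))
    = (\<lambda>n. fact k * (Re (inverse (lattice_point y t (real n + \<theta>)) ^ Suc k) +
                        Re (inverse (lattice_point y t (real n + (1 - \<theta>))) ^ Suc k)))"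
  proof
    fix n
    have 1: "2 * of_real pi * \<i> * (z + of_nat n) = - cnj (lattice_point y t (real n + \<theta>))"
      by (simp add: z_def lattice_point_def complex_eq_iff algebra_simps)
    have 2: "2 * of_real pi * \<i> * (of_nat (Suc n) - z) = lattice_point y t (real n + (1 - \<theta>))"
      by (simp add: z_def lattice_point_def complex_eq_iff algebra_simps)
    have "fact k / (2 * of_real pi * \<i>) ^ Suc k * (inverse ((z + of_nat n) ^ Suc k) + inverse ((of_nat (Suc n) - z) ^ Suc k))
      = fact k * (inverse (2 * of_real pi * \<i> * (z + of_nat n)) ^ Suc k + inverse (2 * of_real pi * \<i> * (of_nat (Suc n) - z)) ^ Suc k)"
      unfolding inverse_power_scale [symmetric] by (simp only: divide_inverse mult.assoc)
    also have "\<dots> = of_real (fact k) * (cnj (inverse (lattice_point y t (real n + \<theta>)) ^ Suc k) + inverse (lattice_point y t (real n + (1 - \<theta>))) ^ Suc k)"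
      unfolding 1 2 using ev by (simp del: power_Suc)
    also have "Re \<dots> = fact k * (Re (inverse (lattice_point y t (real n + \<theta>)) ^ Suc k) +
                        Re (inverse (lattice_point y t (real n + (1 - \<theta>))) ^ Suc k))"
      by (simp only: Re_complex_of_real Im_complex_of_real times_complex.sel plus_complex.sel cnj.sel mult_zero_left diff_zero)
    finally show "Re (fact k / (2 * of_real pi * \<i>) ^ Suc k * (inverse ((z + of_nat n) ^ Suc k) + inverse ((of_nat (Suc n) - z) ^ Suc k))) =
       fact k * (Re (inverse (lattice_point y t (real n + \<theta>)) ^ Suc k) +
                        Re (inverse (lattice_point y t (real n + (1 - \<theta>))) ^ Suc k))" .
  qed
  finally show ?thesis .
qed

text \<open>The same formula at z = 2 pi i u / y, scaled by \<open>y\<close>, so that exponentials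
  in 1 / y appear. Translates on opposite sides of the origin give conjugate points, so the full sum
  counts every m >= 1 twice and m = 0 once. Solving for the half sum leaves the m = 0 term, the
  source of the Hurwitz zeta value.\<close>

lemma lattice_column_suminf:
  assumes y: "y > 0" and u: "u > 0" and k: "odd k"
    and sm: "summable (\<lambda>m. Re (inverse (lattice_point y (real (Suc m)) u) ^ Suc k))"
  shows "(\<Sum>m. Re (inverse (lattice_point y (real (Suc m)) u) ^ Suc k)) =
     (-1) ^ (Suc k div 2) / 2 * ((2 * pi) ^ Suc k / (fact k * y ^ Suc k) * (\<Sum>d. real d ^ k * exp (- (4 * pi^2 / y * (real d * u))))
        - inverse ((2 * pi * u) ^ Suc k))"
proof -
  define z where "z = Complex 0 (2 * pi * u / y)"
  define w where "w = (\<lambda>m. Re (inverse (lattice_point y (real m) u) ^ Suc k))"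
  define E where "E = (\<Sum>d. real d ^ k * exp (- (4 * pi^2 / y * (real d * u))))"
  define c where "c = (-1) ^ (Suc k div 2) * (2 * pi) ^ Suc k / (fact k * y ^ Suc k)"
  have ev: "even (Suc k)" using k by simp
  have Imz: "Im z > 0" using y u by (simp add: z_def)
  have q: "exp (2 * of_real pi * \<i> * z) ^ d = of_real (exp (- (4 * pi^2 / y * (real d * u))))" for d
  proof -
    have "exp (2 * of_real pi * \<i> * z) ^ d = exp (of_nat d * (2 * of_real pi * \<i> * z))"
      by (simp add: exp_of_nat_mult)
    also have "of_nat d * (2 * of_real pi * \<i> * z) = of_real (- (4 * pi^2 / y * (real d * u)))"
      by (simp add: z_def complex_eq_iff power2_eq_square)
    finally show ?thesis by (simp only: exp_of_real)
  qed
  have sm': "summable (\<lambda>d. real d ^ k * exp (- (4 * pi^2 / y * (real d * u))))"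
  proof -
    have "exp (- (4 * pi^2 / y * u)) ^ d = exp (- (4 * pi^2 / y * (real d * u)))" for d
    proof -
      have "real d * (- (4 * pi^2 / y * u)) = - (4 * pi^2 / y * (real d * u))" by simp
      thus ?thesis by (simp only: exp_of_nat_mult [symmetric])
    qed
    moreover have "norm (exp (- (4 * pi^2 / y * u))) < 1" using y u by simp
    ultimately show ?thesis
      using summable_power_times_geometric[of "exp (- (4 * pi^2 / y * u))" k] by simp
  qed
  have E: "(\<Sum>d. of_nat d ^ k * exp (2 * of_real pi * \<i> * z) ^ d) = of_real E"
    unfolding q E_def using sums_of_real[OF summable_sums[OF sm'], where 'a = complex]
    by (intro sums_unique [symmetric]) simp
  have "(\<lambda>n. inverse (of_real y ^ Suc k) * (inverse ((z + of_nat n) ^ Suc k) + inverse ((of_nat (Suc n) - z) ^ Suc k)))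
     sums (inverse (of_real y ^ Suc k) * ((2 * of_real pi * \<i>) ^ Suc k / fact k * of_real E))"
    unfolding E [symmetric] by (intro sums_mult lipschitz_formula Imz k)
  also have "inverse (of_real y ^ Suc k) * ((2 * of_real pi * \<i>) ^ Suc k / fact k * of_real E) = complex_of_real (c * E)"
  proof -
    have *: "inverse Y * (s * P / f * e) = s * P / (f * Y) * e" if "Y \<noteq> 0" "f \<noteq> 0" for Y s P f e :: complex
      using that by (simp add: field_simps)
    have "inverse (of_real y ^ Suc k) * ((2 * of_real pi * \<i>) ^ Suc k / fact k * of_real E) =
        of_real ((-1) ^ (Suc k div 2)) * (2 * of_real pi) ^ Suc k / (fact k * of_real y ^ Suc k) * of_real E"
      unfolding neg_one_power_half_even[OF ev] by (rule *) (use y in auto)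
    also have "\<dots> = complex_of_real (c * E)"
      unfolding c_def by (simp del: power_Suc)
    finally show ?thesis .
  qed
  finally have "(\<lambda>n. inverse (of_real y ^ Suc k) * (inverse ((z + of_nat n) ^ Suc k) + inverse ((of_nat (Suc n) - z) ^ Suc k)))
     sums complex_of_real (c * E)" .
  from sums_Re[OF this]
  have "(\<lambda>n. Re (inverse (of_real y ^ Suc k) * (inverse ((z + of_nat n) ^ Suc k) + inverse ((of_nat (Suc n) - z) ^ Suc k))))
     sums (c * E)"
    by (simp only: Re_complex_of_real)
  also have "(\<lambda>n. Re (inverse (of_real y ^ Suc k) * (inverse ((z + of_nat n) ^ Suc k) + inverse ((of_nat (Suc n) - z) ^ Suc k))))
    = (\<lambda>n. w n + w (Suc n))"
  proof
    fix n
    have 1: "of_real y * (z + of_nat n) = lattice_point y (real n) u"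
      using y by (simp add: z_def lattice_point_def complex_eq_iff)
    have 2: "of_real y * (of_nat (Suc n) - z) = cnj (lattice_point y (real (Suc n)) u)"
      using y by (simp add: z_def lattice_point_def complex_eq_iff)
    have "inverse (of_real y ^ Suc k) * (inverse ((z + of_nat n) ^ Suc k) + inverse ((of_nat (Suc n) - z) ^ Suc k))
      = inverse (of_real y * (z + of_nat n)) ^ Suc k + inverse (of_real y * (of_nat (Suc n) - z)) ^ Suc k"
      by (rule inverse_power_scale)
    also have "\<dots> = inverse (lattice_point y (real n) u) ^ Suc k + cnj (inverse (lattice_point y (real (Suc n)) u) ^ Suc k)"
      unfolding 1 2 by simp
    also have "Re \<dots> = w n + w (Suc n)"
      by (simp only: w_def plus_complex.sel cnj.sel)
    finally show "Re (inverse (of_real y ^ Suc k) * (inverse ((z + of_nat n) ^ Suc k) + inverse ((of_nat (Suc n) - z) ^ Suc k))) = w n + w (Suc n)" .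
  qed
  finally have *: "(\<lambda>n. w n + w (Suc n)) sums (c * E)" .
  have sw1: "summable (\<lambda>n. w (Suc n))" using sm by (simp add: w_def)
  hence sw: "summable w" by (simp add: summable_Suc_iff)
  have "c * E = (\<Sum>n. w n + w (Suc n))" using * by (rule sums_unique)
  also have "\<dots> = suminf w + (\<Sum>n. w (Suc n))" by (rule suminf_add [symmetric, OF sw sw1])
  also have "suminf w = w 0 + (\<Sum>n. w (Suc n))" using suminf_split_head[OF sw] by simp
  finally have **: "(\<Sum>n. w (Suc n)) = (c * E - w 0) / 2" by simp
  have m1: "inverse ((-1) ^ j) = ((-1) ^ j :: complex)" for j
    by (simp flip: power_inverse)
  \<comment> \<open>At m = 0 the point is purely imaginary, so its even power is real with sign
    (-1)^((k+1)/2).\<close>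
  have "lattice_point y (real 0) u = of_real (2 * pi * u) * \<i>"
    by (simp add: lattice_point_def complex_eq_iff)
  hence "inverse (lattice_point y (real 0) u) ^ Suc k = inverse (of_real ((-1) ^ (Suc k div 2)) * of_real (2 * pi * u) ^ Suc k)"
    by (simp only: neg_one_power_half_even[OF ev] power_inverse)
  also have "\<dots> = of_real ((-1) ^ (Suc k div 2) * inverse ((2 * pi * u) ^ Suc k))"
    by (simp del: power_Suc add: inverse_mult_distrib power_inverse m1)
  finally have "w 0 = (-1) ^ (Suc k div 2) * inverse ((2 * pi * u) ^ Suc k)"
    unfolding w_def by (simp only: Re_complex_of_real)
  thus ?thesis using ** unfolding E_def [symmetric] w_def c_def by (simp add: field_simps del: power_Suc)
qed

text \<open>Row sums of the lattice give the left-hand terms, column sums give \<open>E\<close>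
  minus inverse powers of 2 pi (n + \<alpha>), and \<open>lattice_sum_swap\<close> compares the
  totals for \<alpha> = \<theta> and \<alpha> = 1 - \<theta> separately. The result resembles a
  modular transformation from y to 4 pi^2 / y.\<close>

theorem twisted_divisor_series_transformation:
  assumes y: "y > 0" and th: "0 < \<theta>" "\<theta> < 1" and k: "odd k"
  defines "E \<equiv> (\<lambda>\<alpha> n. \<Sum>d. real d ^ k * exp (- (4 * pi^2 / y * (real d * (real n + \<alpha>)))))"
  shows "summable (E \<theta>)" "summable (E (1 - \<theta>))"
    "(\<lambda>m. \<Sum>d. real d ^ k * cos (2 * pi * real d * \<theta>) * exp (- (real d * real (Suc m) * y))) sums
      ((-1) ^ (Suc k div 2) * (2 * pi) ^ Suc k / (2 * y ^ Suc k) * ((\<Sum>n. E \<theta> n) + (\<Sum>n. E (1 - \<theta>) n))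
       - (-1) ^ (Suc k div 2) * fact k / (2 * (2 * pi) ^ Suc k) * (hurwitz_zeta (real k + 1) \<theta> + hurwitz_zeta (real k + 1) (1 - \<theta>))
       - (if k = 1 then 1 / (2 * y) else 0))"
proof -
  define s :: real where "s = (-1) ^ (Suc k div 2)"
  define W where "W = (\<lambda>\<alpha> m n. Re (inverse (lattice_point y (real (Suc m)) (real n + \<alpha>)) ^ Suc k))"
  define \<delta> where "\<delta> = (if k = 1 then 1 / (4 * y) else 0)"
  have k0: "k > 0" using k by (auto intro!: Nat.gr0I)
  have s0: "s \<noteq> 0" "s * s = 1" by (simp_all add: s_def flip: power_add)
  have main: "summable (E \<alpha>) \<and> (\<lambda>m. \<Sum>n. W \<alpha> m n) sums
     (s / 2 * ((2 * pi) ^ Suc k / (fact k * y ^ Suc k) * (\<Sum>n. E \<alpha> n) - hurwitz_zeta (real k + 1) \<alpha> / (2 * pi) ^ Suc k) - \<delta>) \<and>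
     (\<forall>m. summable (W \<alpha> m))" if al: "\<alpha> > 0" for \<alpha>
  proof -
    note sw = lattice_sum_swap[OF y al, of "Suc k"]
    from sw(3) k0 obtain S where S: "(\<lambda>m. \<Sum>n. W \<alpha> m n) sums S" "(\<lambda>n. \<Sum>m. W \<alpha> m n) sums (S + \<delta>)"
      unfolding W_def \<delta>_def by auto
    have col: "(\<Sum>m. W \<alpha> m n) = s / 2 * ((2 * pi) ^ Suc k / (fact k * y ^ Suc k) * E \<alpha> n - inverse ((2 * pi * (real n + \<alpha>)) ^ Suc k))" for n
      unfolding W_def E_def s_def using sw(2)[of n] k0 al
      by (intro lattice_column_suminf y k) (auto simp del: power_Suc)
    have hz: "(\<lambda>n. inverse ((2 * pi * (real n + \<alpha>)) ^ Suc k)) sums (hurwitz_zeta (real k + 1) \<alpha> / (2 * pi) ^ Suc k)"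
    proof -
      have "(\<lambda>n. (real n + \<alpha>) powr (- (real k + 1))) sums hurwitz_zeta (real k + 1) \<alpha>"
        unfolding hurwitz_zeta_def using k0 al by (intro summable_sums summable_shifted_powr) auto
      hence "(\<lambda>n. (real n + \<alpha>) powr (- (real k + 1)) / (2 * pi) ^ Suc k) sums (hurwitz_zeta (real k + 1) \<alpha> / (2 * pi) ^ Suc k)"
        by (rule sums_divide)
      also have "(\<lambda>n. (real n + \<alpha>) powr (- (real k + 1)) / (2 * pi) ^ Suc k) = (\<lambda>n. inverse ((2 * pi * (real n + \<alpha>)) ^ Suc k))"
      proof
        fix n
        have "- (real k + 1) = - real (Suc k)" by simp
        hence "(real n + \<alpha>) powr (- (real k + 1)) = inverse ((real n + \<alpha>) powr real (Suc k))"
          by (simp only: powr_minus)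
        also have "\<dots> = inverse ((real n + \<alpha>) ^ Suc k)"
          using al by (subst powr_realpow) auto
        finally have powr_eq: "(real n + \<alpha>) powr (- (real k + 1)) = inverse ((real n + \<alpha>) ^ Suc k)" .
        have "(2 * pi * (real n + \<alpha>)) ^ Suc k = (2 * pi) ^ Suc k * (real n + \<alpha>) ^ Suc k"
          by (rule power_mult_distrib)
        thus "(real n + \<alpha>) powr (- (real k + 1)) / (2 * pi) ^ Suc k = inverse ((2 * pi * (real n + \<alpha>)) ^ Suc k)"
          by (simp only: powr_eq divide_inverse inverse_mult_distrib mult.commute[of "inverse ((real n + \<alpha>) ^ Suc k)"])
      qed
      finally show ?thesis .
    qed
    define c where "c = (2 * pi) ^ Suc k / (fact k * y ^ Suc k)"
    have c0: "c \<noteq> 0" using y by (simp add: c_def)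
    \<comment> \<open>As s^2 = 1, multiplying by \<open>2 * s\<close> solves the column formula for
      \<open>E\<close>. Convergence of \<open>E\<close> is not estimated but inherited from the
      column sums and the zeta series.\<close>
    have "(\<lambda>n. 2 * s * (\<Sum>m. W \<alpha> m n)) sums (2 * s * (S + \<delta>))"
      by (rule sums_mult[OF S(2)])
    also have "(\<lambda>n. 2 * s * (\<Sum>m. W \<alpha> m n)) = (\<lambda>n. c * E \<alpha> n - inverse ((2 * pi * (real n + \<alpha>)) ^ Suc k))"
    proof
      fix n
      have "2 * s * (\<Sum>m. W \<alpha> m n) = (s * s) * (c * E \<alpha> n - inverse ((2 * pi * (real n + \<alpha>)) ^ Suc k))"
        unfolding col c_def by simp
      thus "2 * s * (\<Sum>m. W \<alpha> m n) = c * E \<alpha> n - inverse ((2 * pi * (real n + \<alpha>)) ^ Suc k)"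
        using s0 by simp
    qed
    finally have "(\<lambda>n. c * E \<alpha> n) sums (2 * s * (S + \<delta>) + hurwitz_zeta (real k + 1) \<alpha> / (2 * pi) ^ Suc k)"
      using sums_add[OF _ hz] by fastforce
    from sums_divide[OF this, of c] have E: "E \<alpha> sums ((2 * s * (S + \<delta>) + hurwitz_zeta (real k + 1) \<alpha> / (2 * pi) ^ Suc k) / c)"
      using c0 by simp
    have "c * suminf (E \<alpha>) - hurwitz_zeta (real k + 1) \<alpha> / (2 * pi) ^ Suc k = 2 * s * (S + \<delta>)"
      unfolding sums_unique[OF E, symmetric] using c0 by simp
    hence "s / 2 * (c * suminf (E \<alpha>) - hurwitz_zeta (real k + 1) \<alpha> / (2 * pi) ^ Suc k) = (s * s) * (S + \<delta>)"
      by simp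
    hence "s / 2 * (c * suminf (E \<alpha>) - hurwitz_zeta (real k + 1) \<alpha> / (2 * pi) ^ Suc k) - \<delta> = S"
      by (simp only: s0(2) mult_1_left add_diff_cancel_right')
    with S(1) sums_summable[OF E] sw(1) k0 show ?thesis
      unfolding c_def W_def by auto
  qed
  have th': "1 - \<theta> > 0" using th by simp
  note m1 = main[OF th(1)] and m2 = main[OF th']
  show "summable (E \<theta>)" "summable (E (1 - \<theta>))" using m1 m2 by auto
  have row: "(\<Sum>d. real d ^ k * cos (2 * pi * real d * \<theta>) * exp (- (real d * real (Suc m) * y))) =
     fact k * ((\<Sum>n. W \<theta> m n) + (\<Sum>n. W (1 - \<theta>) m n))" for m
  proof -
    have "(\<lambda>n. fact k * (W \<theta> m n + W (1 - \<theta>) m n)) sums (fact k * ((\<Sum>n. W \<theta> m n) + (\<Sum>n. W (1 - \<theta>) m n)))"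
      using m1 m2 by (intro sums_mult sums_add summable_sums) auto
    moreover have "(\<lambda>n. fact k * (W \<theta> m n + W (1 - \<theta>) m n)) sums
       (\<Sum>d. real d ^ k * cos (2 * pi * real d * \<theta>) * exp (- (real d * real (Suc m) * y)))"
      unfolding W_def by (rule lattice_row_sums[OF y _ th k]) simp
    ultimately show ?thesis by (rule sums_unique2 [symmetric])
  qed
  define Z1 Z2 where "Z1 = hurwitz_zeta (real k + 1) \<theta>" and "Z2 = hurwitz_zeta (real k + 1) (1 - \<theta>)"
  define P where "P = (2 * pi) ^ Suc k"
  have P0: "P \<noteq> 0" by (simp add: P_def)
  \<comment> \<open>The defect occurs only for \<open>k = 1\<close>, where the factorial is 1. Each
    of the two shifts contributes 1 / (4 y), hence 1 / (2 y) in total.\<close>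
  have fd: "fact k * \<delta> = \<delta>" by (simp add: \<delta>_def)
  have "(\<lambda>m. fact k * ((\<Sum>n. W \<theta> m n) + (\<Sum>n. W (1 - \<theta>) m n))) sums
     (fact k * ((s / 2 * (P / (fact k * y ^ Suc k) * suminf (E \<theta>) - Z1 / P) - \<delta>) +
       (s / 2 * (P / (fact k * y ^ Suc k) * suminf (E (1 - \<theta>)) - Z2 / P) - \<delta>)))"
    using m1 m2 unfolding P_def Z1_def Z2_def by (intro sums_mult sums_add) auto
  also have "(fact k * ((s / 2 * (P / (fact k * y ^ Suc k) * suminf (E \<theta>) - Z1 / P) - \<delta>) +
       (s / 2 * (P / (fact k * y ^ Suc k) * suminf (E (1 - \<theta>)) - Z2 / P) - \<delta>)))
     = s * P / (2 * y ^ Suc k) * (suminf (E \<theta>) + suminf (E (1 - \<theta>))) - s * fact k / (2 * P) * (Z1 + Z2) - 2 * (fact k * \<delta>)"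
    using y P0 by (simp add: field_simps del: power_Suc)
  also have "2 * (fact k * \<delta>) = (if k = 1 then 1 / (2 * y) else 0)"
    unfolding fd by (simp add: \<delta>_def)
  finally show "(\<lambda>m. \<Sum>d. real d ^ k * cos (2 * pi * real d * \<theta>) * exp (- (real d * real (Suc m) * y))) sums
      ((-1) ^ (Suc k div 2) * (2 * pi) ^ Suc k / (2 * y ^ Suc k) * ((\<Sum>n. E \<theta> n) + (\<Sum>n. E (1 - \<theta>) n))
       - (-1) ^ (Suc k div 2) * fact k / (2 * (2 * pi) ^ Suc k) * (hurwitz_zeta (real k + 1) \<theta> + hurwitz_zeta (real k + 1) (1 - \<theta>))
       - (if k = 1 then 1 / (2 * y) else 0))"
    unfolding row s_def P_def Z1_def Z2_def .
qed

section \<open>Termwise integration\<close>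

lemma Gamma_integrand:
  fixes s :: complex
  assumes "Re s > 0"
  shows "(\<lambda>t. complex_of_real t powr (s - 1) * complex_of_real (exp (- t))) absolutely_integrable_on {0<..}"
    and "((\<lambda>t. complex_of_real t powr (s - 1) * complex_of_real (exp (- t))) has_integral Gamma s) {0<..}"
  using absolutely_integrable_Gamma_integral'[OF assms] Gamma_integral_complex'[OF assms]
  by (simp_all add: exp_minus divide_inverse)

lemma Gamma_integrand_real:
  assumes "r > 0"
  shows "(\<lambda>t. t powr (r - 1) * exp (- t)) absolutely_integrable_on {(0::real)<..}"
proof -
  have "(\<lambda>t. norm (complex_of_real t powr (of_real r - 1) * complex_of_real (exp (- t)))) absolutely_integrable_on {0<..}"
    by (intro absolutely_integrable_norm[unfolded o_def] Gamma_integrand) (use assms in simp)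
  also have "?this \<longleftrightarrow> ?thesis"
    by (intro absolutely_integrable_spike_eq[of "{}"]) (auto simp: norm_mult norm_powr_real_powr)
  finally show ?thesis .
qed

lemma Gamma_integral_scaled:
  fixes s :: complex
  assumes "Re s > 0" "c > 0"
  shows "integral {0<..} (\<lambda>t. complex_of_real t powr (s - 1) * complex_of_real (exp (- (c * t)))) = Gamma s / of_real c powr s"
proof -
  let ?f = "\<lambda>t. complex_of_real t powr (s - 1) * complex_of_real (exp (- t))"
  have img: "(\<lambda>t. c * t) ` {0<..} = {0<..}"
  proof safe
    fix t :: real assume "t > 0"
    thus "t \<in> (\<lambda>t. c * t) ` {0<..}"
      using assms by (intro image_eqI[of _ _ "t / c"]) auto
  qed (use assms in auto)
  have "(\<lambda>t. \<bar>c\<bar> *\<^sub>R ?f (c * t)) absolutely_integrable_on {0<..} \<and> integral {0<..} (\<lambda>t. \<bar>c\<bar> *\<^sub>R ?f (c * t)) = Gamma s"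
    by (subst has_absolute_integral_change_of_variables_real[of _ "\<lambda>t. c * t"], unfold img)
       (use assms Gamma_integrand[OF assms(1)] in \<open>auto intro!: derivative_eq_intros inj_onI integral_unique\<close>)
  hence "Gamma s = integral {0<..} (\<lambda>t. \<bar>c\<bar> *\<^sub>R ?f (c * t))" by simp
  also have "\<dots> = integral {0<..} (\<lambda>t. of_real c powr s * (complex_of_real t powr (s - 1) * complex_of_real (exp (- (c * t)))))"
  proof (rule integral_cong)
    fix t :: real assume t: "t \<in> {0<..}"
    have "of_real c powr s = of_real c * of_real c powr (s - 1)"
      using assms by (simp add: powr_diff)
    moreover have "complex_of_real (c * t) powr (s - 1) = of_real c powr (s - 1) * of_real t powr (s - 1)"
      unfolding of_real_mult by (rule powr_times_real) (use assms t in auto)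
    ultimately show "\<bar>c\<bar> *\<^sub>R ?f (c * t) = of_real c powr s * (complex_of_real t powr (s - 1) * complex_of_real (exp (- (c * t))))"
      using assms by (simp add: scaleR_conv_of_real)
  qed
  also have "\<dots> = of_real c powr s * integral {0<..} (\<lambda>t. complex_of_real t powr (s - 1) * complex_of_real (exp (- (c * t))))"
    by (rule integral_mult_right)
  finally show ?thesis using assms by (simp add: field_simps)
qed

text \<open>Raise w / s <= exp(w / s) to the power \<open>s\<close>. Trading exponential decay for
  an arbitrary power yields majorants whose variables separate.\<close>

lemma exp_minus_le_powr:
  fixes s w :: real
  assumes "s > 0" "w > 0"
  shows "exp (- w) \<le> s powr s * w powr (- s)"
proof -
  have "w / s \<le> exp (w / s)"
    using exp_ge_add_one_self[of "w / s"] by linarith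
  hence "(w / s) powr s \<le> exp (w / s) powr s"
    using assms by (intro powr_mono2) auto
  also have "\<dots> = exp w" using assms by (simp add: powr_def)
  finally have "w powr s / s powr s \<le> exp w" using assms by (simp add: powr_divide)
  hence "inverse (exp w) \<le> inverse (w powr s / s powr s)"
    using assms by (intro le_imp_inverse_le) auto
  thus ?thesis using assms by (simp add: exp_minus powr_minus field_simps)
qed

lemma absolutely_integrable_continuous_dominated:
  fixes f :: "real \<Rightarrow> complex"
  assumes "continuous_on {0<..} f" "G absolutely_integrable_on {0<..}" "\<And>t. t > 0 \<Longrightarrow> norm (f t) \<le> b * G t"
  shows "f absolutely_integrable_on {0<..}"
proof (rule measurable_bounded_by_integrable_imp_absolutely_integrable)
  show "f \<in> borel_measurable (lebesgue_on {0<..})"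
    using assms(1) by (rule continuous_imp_measurable_on_sets_lebesgue) auto
  show "(\<lambda>t. b * G t) integrable_on {0<..}"
    using set_lebesgue_integral_eq_integral(1)[OF assms(2)] by (intro integrable_on_mult_right)
qed (use assms in auto)

text \<open>Because the majorant is a product \<open>b n * G t\<close>, the integrals of the norms
  are at most \<open>b n\<close> times one fixed integral, hence summable, and termwise integration
  applies.\<close>

lemma integral_series:
  fixes f :: "nat \<Rightarrow> real \<Rightarrow> complex"
  assumes cont: "\<And>n. continuous_on {0<..} (f n)"
    and G: "G absolutely_integrable_on {0<..}"
    and bound: "\<And>n t. t > 0 \<Longrightarrow> norm (f n t) \<le> b n * G t"
    and b: "summable b"
  shows "(\<lambda>t. \<Sum>n. f n t) absolutely_integrable_on {0<..}"
    and "(\<lambda>n. integral {0<..} (f n)) sums integral {0<..} (\<lambda>t. \<Sum>n. f n t)"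
    and "norm (integral {0<..} (f n)) \<le> b n * integral {0<..} G"
proof -
  let ?M = "lebesgue_on {(0::real)<..}"
  have meas: "{(0::real)<..} \<in> sets lebesgue" by simp
  have ai: "f n absolutely_integrable_on {0<..}" for n
    by (rule absolutely_integrable_continuous_dominated[OF cont G bound])
  have iff: "g absolutely_integrable_on {0<..} \<longleftrightarrow> integrable ?M g" for g :: "real \<Rightarrow> complex"
    unfolding set_integrable_def by (rule integrable_restrict_space [symmetric]) auto
  have Gi: "G integrable_on {0<..}"
    using G by (rule set_lebesgue_integral_eq_integral)
  have bn: "norm (integral {0<..} (f n)) \<le> b n * integral {0<..} G"
    and bn': "integral {0<..} (\<lambda>t. norm (f n t)) \<le> b n * integral {0<..} G" for n
  proof -
    have "norm (integral {0<..} (f n)) \<le> integral {0<..} (\<lambda>t. b n * G t)"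
      using ai[of n] by (intro integral_norm_bound_integral integrable_on_mult_right Gi set_lebesgue_integral_eq_integral(1) bound) auto
    thus "norm (integral {0<..} (f n)) \<le> b n * integral {0<..} G" by simp
    have "integral {0<..} (\<lambda>t. norm (f n t)) \<le> integral {0<..} (\<lambda>t. b n * G t)"
      using absolutely_integrable_norm[OF ai[of n]]
      by (intro integral_le integrable_on_mult_right Gi bound)
         (auto simp: o_def dest: set_lebesgue_integral_eq_integral(1))
    thus "integral {0<..} (\<lambda>t. norm (f n t)) \<le> b n * integral {0<..} G" by simp
  qed
  show "norm (integral {0<..} (f n)) \<le> b n * integral {0<..} G" by (rule bn)
  have int: "integrable ?M (f n)" for n using ai iff by blast
  have AE: "AE t in ?M. summable (\<lambda>n. norm (f n t))"
  proof (rule AE_I2)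
    fix t assume "t \<in> space ?M"
    hence "t > 0" by simp
    thus "summable (\<lambda>n. norm (f n t))"
      by (intro summable_comparison_test'[OF summable_mult2[OF b, of "G t"], of 0]) (use bound in auto)
  qed
  have sm: "summable (\<lambda>n. \<integral>t. norm (f n t) \<partial>?M)"
  proof (rule summable_comparison_test'[OF summable_mult2[OF b, of "integral {0<..} G"], of 0])
    fix n
    have "(\<integral>t. norm (f n t) \<partial>?M) = integral {0<..} (\<lambda>t. norm (f n t))"
      by (rule lebesgue_integral_eq_integral) (use int in auto)
    moreover have "(\<integral>t. norm (f n t) \<partial>?M) \<ge> 0"
      by (rule integral_nonneg_AE) simp
    ultimately show "norm (\<integral>t. norm (f n t) \<partial>?M) \<le> b n * integral {0<..} G"
      using bn'[of n] by simp
  qed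
  have Si: "integrable ?M (\<lambda>t. \<Sum>n. f n t)"
    by (rule integrable_suminf[OF int AE sm])
  thus "(\<lambda>t. \<Sum>n. f n t) absolutely_integrable_on {0<..}" using iff by blast
  show "(\<lambda>n. integral {0<..} (f n)) sums integral {0<..} (\<lambda>t. \<Sum>n. f n t)"
    using sums_integral[OF int AE sm]
    by (simp only: lebesgue_integral_eq_integral[OF int meas] lebesgue_integral_eq_integral[OF Si meas])
qed

section \<open>Double series under the integral sign\<close>

lemma sums_prod_decode:
  fixes f :: "nat \<Rightarrow> nat \<Rightarrow> 'a :: banach"
  assumes "(\<lambda>(m, n). norm (f m n)) summable_on UNIV"
  shows "(\<lambda>j. case prod_decode j of (m, n) \<Rightarrow> f m n) sums infsum (\<lambda>(m, n). f m n) UNIV"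
proof -
  have "(\<lambda>(m, n). f m n) summable_on UNIV"
    by (rule abs_summable_summable) (use assms in \<open>simp add: case_prod_unfold\<close>)
  hence "((\<lambda>(m, n). f m n) has_sum infsum (\<lambda>(m, n). f m n) UNIV) UNIV" by simp
  hence "((\<lambda>j. (\<lambda>(m, n). f m n) (prod_decode j)) has_sum infsum (\<lambda>(m, n). f m n) UNIV) UNIV"
    by (subst has_sum_reindex_bij_betw[OF bij_prod_decode])
  thus ?thesis by (rule has_sum_imp_sums)
qed

text \<open>Pairs are enumerated by \<open>prod_decode\<close>, which reduces the claim to simple
  series. The order of summation differs between the two sides: the integrand arises with
  \<open>m\<close> as inner index, whereas the final formula has it outside.\<close>

lemma integral_double_series:
  fixes f :: "nat \<Rightarrow> nat \<Rightarrow> real \<Rightarrow> complex"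
  assumes cont: "\<And>m n. continuous_on {0<..} (f m n)"
    and G: "G absolutely_integrable_on {0<..}"
    and bound: "\<And>m n t. t > 0 \<Longrightarrow> norm (f m n t) \<le> g m * h n * G t"
    and gh: "summable g" "summable h" "\<And>m. g m \<ge> 0" "\<And>n. h n \<ge> 0"
  shows "(\<lambda>t. \<Sum>n. \<Sum>m. f m n t) absolutely_integrable_on {0<..}"
    and "(\<lambda>(m, n). norm (integral {0<..} (f m n))) summable_on UNIV"
    and "integral {0<..} (\<lambda>t. \<Sum>n. \<Sum>m. f m n t) = (\<Sum>m. \<Sum>n. integral {0<..} (f m n))"
proof -
  let ?f = "\<lambda>j. case prod_decode j of (m, n) \<Rightarrow> f m n"
  let ?b = "\<lambda>j. case prod_decode j of (m, n) \<Rightarrow> g m * h n"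
  have "(\<lambda>(m, n). norm (g m * h n)) summable_on UNIV"
    by (rule summable_on_prod_dominated[OF gh(1,2)]) (use gh in \<open>auto simp: abs_mult\<close>)
  from sums_summable[OF sums_prod_decode[OF this]] have b: "summable ?b" .
  have cont': "continuous_on {0<..} (?f j)" for j
    by (auto split: prod.split intro: cont)
  have bound': "norm (?f j t) \<le> ?b j * G t" if "t > 0" for j t
    using bound[OF that] by (auto split: prod.split)
  note series = integral_series[of ?f G ?b, OF cont' G bound' b]
  have decode: "(\<Sum>j. ?f j t) = (\<Sum>n. \<Sum>m. f m n t)" if "t \<in> {0<..}" for t
  proof -
    have "(\<lambda>(m, n). norm (f m n t)) summable_on UNIV"
    proof (rule summable_on_prod_dominated)
      show "summable (\<lambda>m. g m * \<bar>G t\<bar>)" by (intro summable_mult2 gh)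
      fix m n
      have "norm (f m n t) \<le> g m * h n * \<bar>G t\<bar>"
        using bound[of t m n] that gh(3)[of m] gh(4)[of n]
        by (intro order_trans[OF bound] mult_left_mono) auto
      thus "norm (f m n t) \<le> g m * \<bar>G t\<bar> * h n" by (simp add: mult_ac)
    qed (use gh in auto)
    note abs_conv = this infsum_prod_swap[OF this]
    show ?thesis
      using sums_unique[OF sums_prod_decode[OF abs_conv(1)]] sums_unique[OF iterated_sums_infsum(2)[OF abs_conv(2)]] abs_conv(3)
      by (simp add: case_prod_unfold)
  qed
  have "(\<lambda>t. \<Sum>j. ?f j t) absolutely_integrable_on {0<..} \<longleftrightarrow> (\<lambda>t. \<Sum>n. \<Sum>m. f m n t) absolutely_integrable_on {0<..}"
    by (intro absolutely_integrable_spike_eq[of "{}"]) (use decode in auto)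
  thus "(\<lambda>t. \<Sum>n. \<Sum>m. f m n t) absolutely_integrable_on {0<..}"
    using series(1) by blast
  have nb: "norm (integral {0<..} (f m n)) \<le> g m * \<bar>integral {0<..} G\<bar> * h n" for m n
  proof -
    have "norm (integral {0<..} (f m n)) \<le> g m * h n * integral {0<..} G"
      using series(3)[of "prod_encode (m, n)"] by simp
    also have "\<dots> \<le> g m * h n * \<bar>integral {0<..} G\<bar>"
      using gh(3)[of m] gh(4)[of n] by (intro mult_left_mono) auto
    finally show ?thesis by (simp add: mult_ac)
  qed
  show sm: "(\<lambda>(m, n). norm (integral {0<..} (f m n))) summable_on UNIV"
    by (rule summable_on_prod_dominated[OF summable_mult2[OF gh(1)] gh(2) nb]) (use gh in auto)
  have "integral {0<..} (\<lambda>t. \<Sum>n. \<Sum>m. f m n t) = integral {0<..} (\<lambda>t. \<Sum>j. ?f j t)"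
    by (intro integral_cong) (use decode in simp)
  also have "\<dots> = (\<Sum>j. integral {0<..} (?f j))"
    using series(2) by (rule sums_unique)
  also have "(\<lambda>j. integral {0<..} (?f j)) = (\<lambda>j. case prod_decode j of (m, n) \<Rightarrow> integral {0<..} (f m n))"
    by (auto simp: fun_eq_iff split: prod.split)
  also have "suminf \<dots> = (\<Sum>m. \<Sum>n. integral {0<..} (f m n))"
    using sums_unique[OF sums_prod_decode[OF sm]] sums_unique[OF iterated_sums_infsum(2)[OF sm]] by simp
  finally show "integral {0<..} (\<lambda>t. \<Sum>n. \<Sum>m. f m n t) = (\<Sum>m. \<Sum>n. integral {0<..} (f m n))" .
qed

section \<open>Divisor series and the Bessel integral\<close>

lemma divisor_sums:
  fixes f :: "nat \<Rightarrow> nat \<Rightarrow> 'a :: banach"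
  assumes "(\<lambda>(m, d). norm (f (Suc m) (Suc d))) summable_on UNIV"
  shows "(\<lambda>N. \<Sum>d | d dvd Suc N. f (Suc N div d) d) sums infsum (\<lambda>(m, d). f (Suc m) (Suc d)) UNIV"
proof -
  let ?I = "infsum (\<lambda>(m, d). f (Suc m) (Suc d)) UNIV"
  have "(\<lambda>(m, d). f (Suc m) (Suc d)) summable_on UNIV"
    by (rule abs_summable_summable) (use assms in \<open>simp add: case_prod_unfold\<close>)
  hence "((\<lambda>(m, d). f (Suc m) (Suc d)) has_sum ?I) UNIV" by simp
  also have "?this \<longleftrightarrow> ((\<lambda>(N, d). f (Suc N div d) d) has_sum ?I) (Sigma UNIV (\<lambda>N. {d. d dvd Suc N}))"
  \<comment> \<open>Pairs of positive integers correspond to their product together with a chosen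
    divisor. \<open>m\<close>, \<open>N\<close> and the index of the source series start at 0, hence
    the subtractions of 1; the divisor itself is unshifted.\<close>
  proof (rule has_sum_reindex_bij_witness[of _ "\<lambda>(N, d). (Suc N div d - 1, d - 1)" "\<lambda>(m, d). (Suc m * Suc d - 1, Suc d)"])
    fix a :: "nat \<times> nat" assume "a \<in> Sigma UNIV (\<lambda>N. {d. d dvd Suc N})"
    then obtain N d where a: "a = (N, d)" "d dvd Suc N" by auto
    then obtain q where q: "Suc N = q * d" by (metis dvdE mult.commute)
    hence "d > 0" "q > 0" by (auto intro!: Nat.gr0I)
    moreover have "Suc N div d = q" unfolding q using \<open>d > 0\<close> by simp
    moreover from \<open>d > 0\<close> \<open>q > 0\<close> have "Suc (q - 1) = q" "Suc (d - 1) = d" by simp_all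
    moreover have "q * d - 1 = N" unfolding q [symmetric] by simp
    ultimately show "(\<lambda>(m, d). (Suc m * Suc d - 1, Suc d)) ((\<lambda>(N, d). (Suc N div d - 1, d - 1)) a) = a"
      using a(1) by (simp only: prod.case)
  qed (auto simp del: mult_Suc mult_Suc_right)
  finally have "((\<lambda>(N, d). f (Suc N div d) d) has_sum ?I) (Sigma UNIV (\<lambda>N. {d. d dvd Suc N}))" .
  from has_sum_SigmaD[OF this, of "\<lambda>N. \<Sum>d | d dvd Suc N. f (Suc N div d) d"]
  show ?thesis by (intro has_sum_imp_sums) (auto intro!: has_sum_finite simp: finite_divisors_nat)
qed

text \<open>Substituting w = (z / 2) exp t turns w + z^2 / (4 w) into z cosh t and the power of w
  into a multiple of exp(\<nu> t). Folding the line at t = 0 produces 2 cosh(\<nu> t) and with it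
  the integral defining \<open>besselK\<close>.\<close>

lemma besselK_integral:
  fixes \<nu> :: complex
  assumes nu: "Re \<nu> > 0" and z: "z > 0"
  shows "integral {0<..} (\<lambda>w. complex_of_real w powr (\<nu> - 1) * complex_of_real (exp (- w)) * complex_of_real (exp (- (z^2 / 4 / w))))
    = 2 * complex_of_real (z / 2) powr \<nu> * besselK \<nu> z"
proof -
  define f where "f = (\<lambda>w. complex_of_real w powr (\<nu> - 1) * complex_of_real (exp (- w)) * complex_of_real (exp (- (z^2 / 4 / w))))"
  define g where "g = (\<lambda>t. z / 2 * exp t)"
  define h where "h = (\<lambda>t. complex_of_real (z / 2) powr \<nu> * (complex_of_real (exp (- z * cosh t)) * exp (\<nu> * complex_of_real t)))"
  have f_ai: "f absolutely_integrable_on {0<..}"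
  proof (rule absolutely_integrable_continuous_dominated[OF _ Gamma_integrand_real[OF nu]])
    show "continuous_on {0<..} f"
      unfolding f_def by (intro continuous_intros) auto
    fix t :: real assume t: "t > 0"
    have "norm (f t) = t powr (Re \<nu> - 1) * exp (- t) * exp (- (z^2 / 4 / t))"
      using t by (simp add: f_def norm_mult norm_powr_real_powr)
    also have "\<dots> \<le> t powr (Re \<nu> - 1) * exp (- t) * 1"
      using t by (intro mult_left_mono) auto
    finally show "norm (f t) \<le> 1 * (t powr (Re \<nu> - 1) * exp (- t))" by simp
  qed
  have img: "range g = {0<..}"
  proof safe
    fix w :: real assume "w > 0"
    thus "w \<in> range g"
      using z by (intro image_eqI[of _ _ "ln (2 * w / z)"]) (auto simp: g_def)
  qed (use z in \<open>auto simp: g_def\<close>)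
  \<comment> \<open>\<open>g\<close> is its own derivative, so the Jacobian raises the power of the
    substituted variable from \<nu> - 1 to \<nu>.\<close>
  have g': "(g has_real_derivative g t) (at t)" for t
    unfolding g_def by (auto intro!: derivative_eq_intros)
  have inj: "inj g" using z by (auto simp: g_def inj_on_def)
  have h_eq: "\<bar>g t\<bar> *\<^sub>R f (g t) = h t" for t
  proof -
    have gt: "g t > 0" using z by (simp add: g_def)
    have e1: "complex_of_real (g t) powr \<nu> = complex_of_real (g t) * complex_of_real (g t) powr (\<nu> - 1)"
      using gt by (simp add: powr_diff)
    have e2: "complex_of_real (g t) powr \<nu> = complex_of_real (z / 2) powr \<nu> * exp (\<nu> * complex_of_real t)"
    proof -
      have "complex_of_real (g t) powr \<nu> = complex_of_real (z / 2) powr \<nu> * complex_of_real (exp t) powr \<nu>"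
        unfolding g_def of_real_mult by (rule powr_times_real) (use z in auto)
      also have "complex_of_real (exp t) powr \<nu> = exp (\<nu> * complex_of_real t)"
        by (simp add: powr_def Ln_of_real)
      finally show ?thesis .
    qed
    have e3: "complex_of_real (exp (- g t)) * complex_of_real (exp (- (z^2 / 4 / g t))) = complex_of_real (exp (- z * cosh t))"
    proof -
      have "z^2 / 4 / g t = z / 2 * exp (- t)"
        using z by (simp add: g_def exp_minus field_simps power2_eq_square)
      hence "- g t + - (z^2 / 4 / g t) = - z * cosh t"
        unfolding g_def cosh_def by (simp add: algebra_simps)
      thus ?thesis by (simp only: of_real_mult [symmetric] exp_add [symmetric])
    qed
    have "\<bar>g t\<bar> *\<^sub>R f (g t) = (complex_of_real (g t) * complex_of_real (g t) powr (\<nu> - 1)) *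
        (complex_of_real (exp (- g t)) * complex_of_real (exp (- (z^2 / 4 / g t))))"
      using gt unfolding f_def by (simp only: scaleR_conv_of_real abs_of_pos mult.assoc)
    also have "\<dots> = h t"
      unfolding e1 [symmetric] e3 unfolding e2 h_def by (simp only: mult_ac)
    finally show ?thesis .
  qed
  have "(\<lambda>t. \<bar>g t\<bar> *\<^sub>R f (g t)) absolutely_integrable_on UNIV \<and>
     integral UNIV (\<lambda>t. \<bar>g t\<bar> *\<^sub>R f (g t)) = integral {0<..} f"
    by (subst has_absolute_integral_change_of_variables_real[of UNIV g g])
       (use g' inj f_ai img in auto)
  hence h_ai: "h absolutely_integrable_on UNIV" and h_int: "integral UNIV h = integral {0<..} f"
    unfolding h_eq by auto
  have h_pos: "h absolutely_integrable_on {0..}" and h_neg: "h absolutely_integrable_on {..0}"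
    by (rule set_integrable_subset[OF h_ai]; simp)+
  have "(\<lambda>t. \<bar>-1\<bar> *\<^sub>R h (- t)) absolutely_integrable_on {0..} \<and> integral {0..} (\<lambda>t. \<bar>-1\<bar> *\<^sub>R h (- t)) = integral {..0} h"
  proof (subst has_absolute_integral_change_of_variables_real[of _ uminus])
    show "h absolutely_integrable_on uminus ` {0..} \<and> integral (uminus ` {0..}) h = integral {..0} h"
      using h_neg by simp
  qed (auto intro!: derivative_eq_intros)
  hence refl: "(\<lambda>t. h (- t)) absolutely_integrable_on {0..}" "integral {0..} (\<lambda>t. h (- t)) = integral {..0} h"
    by simp_all
  note hi = set_lebesgue_integral_eq_integral(1)
  have "(h has_integral (integral {0..} h + integral {..0} h)) ({0..} \<union> {..0})"
  proof (rule has_integral_Un)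
    have "{0..} \<inter> {..0::real} = {0}" by auto
    thus "negligible ({0..} \<inter> {..0::real})" by simp
  qed (use hi[OF h_pos] hi[OF h_neg] in \<open>auto intro: integrable_integral\<close>)
  moreover have "{0..} \<union> {..0::real} = UNIV" by auto
  ultimately have "integral UNIV h = integral {0..} h + integral {0..} (\<lambda>t. h (- t))"
    unfolding refl by (auto dest: integral_unique)
  also have "\<dots> = integral {0..} (\<lambda>t. h t + h (- t))"
    by (rule integral_add [symmetric, OF hi[OF h_pos] hi[OF refl(1)]])
  also have "(\<lambda>t. h t + h (- t)) = (\<lambda>t. 2 * complex_of_real (z / 2) powr \<nu> * (complex_of_real (exp (- z * cosh t)) * cosh (\<nu> * complex_of_real t)))"
    by (rule ext) (simp add: h_def cosh_def scaleR_conv_of_real algebra_simps)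
  also have "integral {0..} \<dots> = 2 * complex_of_real (z / 2) powr \<nu> * besselK \<nu> z"
    unfolding besselK_def by (rule integral_mult_right)
  finally show ?thesis unfolding h_int f_def .
qed

lemma suminf_shift_zero:
  fixes f :: "nat \<Rightarrow> 'a :: real_normed_vector"
  assumes "summable (\<lambda>n. f (Suc n))" "f 0 = 0"
  shows "suminf f = (\<Sum>n. f (Suc n))"
  using suminf_split_head[of f] assms by (simp add: summable_Suc_iff)

text \<open>A Lambert series: collecting the pairs (m, d) by their product makes the coefficients
  divisor sums. This brings the series into the row form required by
  \<open>twisted_divisor_series_transformation\<close>.\<close>

lemma divisor_exponential_sums:
  fixes c :: "nat \<Rightarrow> real"
  assumes y: "y > 0" and c: "\<And>d. \<bar>c d\<bar> \<le> real d ^ k" "c 0 = 0"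
  shows "(\<lambda>N. (\<Sum>d | d dvd Suc N. c d) * exp (- (real (Suc N) * y))) sums
     (\<Sum>m. \<Sum>d. c d * exp (- (real d * real (Suc m) * y)))"
proof -
  define F where "F = (\<lambda>m d. c d * exp (- (real d * real m * y)))"
  have q: "norm (exp (- y)) < 1" using y by simp
  have exp_pow: "exp (- y) ^ n = exp (- (real n * y))" for n
    by (simp flip: exp_of_nat_mult)
  have "summable (\<lambda>d. real d ^ k * exp (- y) ^ d)"
    by (rule summable_power_times_geometric[OF q, of k])
  hence s1: "summable (\<lambda>d. real (Suc d) ^ k * exp (- y) ^ Suc d)"
    by (subst summable_Suc_iff)
  have s2: "summable (\<lambda>m. exp (- y) ^ m)"
    using q by (rule summable_geometric)
  have abs_conv: "(\<lambda>(m, d). norm (F (Suc m) (Suc d))) summable_on UNIV"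
  proof (rule summable_on_prod_dominated[OF s2 s1])
    fix m d
    have "norm (F (Suc m) (Suc d)) \<le> real (Suc d) ^ k * exp (- (real (Suc d) * real (Suc m) * y))"
      unfolding F_def real_norm_def abs_mult abs_exp_cancel by (intro mult_right_mono c) auto
    \<comment> \<open>From (m + 1)(d + 1) >= m + (d + 1) the exponential is at most a product of one
      exponential in \<open>m\<close> and one in \<open>d\<close>, so the majorant factors.\<close>
    also have "- (real (Suc d) * real (Suc m) * y) \<le> - (real m * y) + - (real (Suc d) * y)"
    proof -
      have "0 \<le> real d * real m * y" using y by simp
      thus ?thesis by (simp add: algebra_simps)
    qed
    hence "exp (- (real (Suc d) * real (Suc m) * y)) \<le> exp (- (real m * y) + - (real (Suc d) * y))" by simp
    hence "real (Suc d) ^ k * exp (- (real (Suc d) * real (Suc m) * y)) \<le> real (Suc d) ^ k * exp (- (real m * y) + - (real (Suc d) * y))"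
      by (rule mult_left_mono) simp
    also have "\<dots> = exp (- y) ^ m * (real (Suc d) ^ k * exp (- y) ^ Suc d)"
      unfolding exp_pow exp_add by (simp only: mult_ac)
    finally show "norm (F (Suc m) (Suc d)) \<le> exp (- y) ^ m * (real (Suc d) ^ k * exp (- y) ^ Suc d)" .
  qed auto
  note conv = iterated_sums_infsum[OF abs_conv]
  have "(\<lambda>N. \<Sum>d | d dvd Suc N. F (Suc N div d) d) sums (\<Sum>m. \<Sum>d. F (Suc m) (Suc d))"
    using divisor_sums[OF abs_conv] sums_unique[OF conv(2)] by simp
  \<comment> \<open>The index d = 0 may be restored because \<open>c 0 = 0\<close>.\<close>
  also have "(\<lambda>m. \<Sum>d. F (Suc m) (Suc d)) = (\<lambda>m. \<Sum>d. F (Suc m) d)"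
    by (rule ext, rule suminf_shift_zero [symmetric])
       (use conv(1) c in \<open>auto intro: summable_norm_cancel simp: F_def\<close>)
  also have "(\<lambda>N. \<Sum>d | d dvd Suc N. F (Suc N div d) d) = (\<lambda>N. (\<Sum>d | d dvd Suc N. c d) * exp (- (real (Suc N) * y)))"
  proof
    fix N
    have "F (Suc N div d) d = c d * exp (- (real (Suc N) * y))" if "d dvd Suc N" for d
    proof -
      have "real d * real (Suc N div d) = real (Suc N)"
        using that by (metis dvd_mult_div_cancel of_nat_mult)
      thus ?thesis unfolding F_def by (simp only:)
    qed
    thus "(\<Sum>d | d dvd Suc N. F (Suc N div d) d) = (\<Sum>d | d dvd Suc N. c d) * exp (- (real (Suc N) * y))"
      unfolding sum_distrib_right by (intro sum.cong) auto
  qed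
  finally show ?thesis unfolding F_def .
qed

lemma divisor_sum_bound:
  fixes c :: "nat \<Rightarrow> real"
  assumes "\<And>d. \<bar>c d\<bar> \<le> real d ^ k" "N > 0"
  shows "\<bar>\<Sum>d | d dvd N. c d\<bar> \<le> real N ^ Suc k"
proof -
  have "\<bar>\<Sum>d | d dvd N. c d\<bar> \<le> (\<Sum>d | d dvd N. \<bar>c d\<bar>)" by (rule sum_abs)
  also have "\<dots> \<le> (\<Sum>d | d dvd N. real N ^ k)"
  proof (rule sum_mono)
    fix d assume "d \<in> {d. d dvd N}"
    hence "d \<le> N" using assms(2) by (auto dest: dvd_imp_le)
    hence "real d ^ k \<le> real N ^ k" by (intro power_mono) auto
    thus "\<bar>c d\<bar> \<le> real N ^ k" using assms(1)[of d] by linarith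
  qed
  also have "\<dots> = real (card {d. d dvd N}) * real N ^ k" by simp
  also have "\<dots> \<le> real N * real N ^ k"
  proof (intro mult_right_mono)
    have "card {d. d dvd N} \<le> card {1..N}"
      using assms(2) by (intro card_mono) (auto dest: dvd_imp_le intro!: Nat.gr0I simp: Suc_le_eq)
    thus "real (card {d. d dvd N}) \<le> real N" by simp
  qed auto
  finally show ?thesis by simp
qed

lemma bessel_divisor_series:
  fixes c :: "nat \<Rightarrow> real" and \<nu> :: complex
  assumes a: "a > 0" and x: "x > 0" and nu: "Re \<nu> > 0"
    and c: "\<And>d. \<bar>c d\<bar> \<le> real d ^ k"
  defines "X \<equiv> a^2 * x / 4"
  defines "\<sigma> \<equiv> (\<lambda>N. \<Sum>d | d dvd N. c d)"
  shows "(\<lambda>n. complex_of_real (real (Suc n)) powr (\<nu> / 2) * besselK \<nu> (a * sqrt (real (Suc n) * x)) * complex_of_real (\<sigma> (Suc n)))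
     sums (integral {0<..} (\<lambda>t. \<Sum>n. complex_of_real t powr (\<nu> - 1) * complex_of_real (exp (- t)) *
             complex_of_real (\<sigma> (Suc n) * exp (- (real (Suc n) * (X / t))))) / (2 * complex_of_real X powr (\<nu> / 2)))"
proof -
  \<comment> \<open>The divisor sums grow at most like N^(k+1), so taking decay N^-(k+3) from the
    exponential leaves the summable N^-2. The accompanying t^r merely raises the Gamma exponent to
    Re \<nu> + r.\<close>
  define r where "r = real (k + 3)"
  define f where "f = (\<lambda>n t. complex_of_real t powr (\<nu> - 1) * complex_of_real (exp (- t)) *
             complex_of_real (\<sigma> (Suc n) * exp (- (real (Suc n) * (X / t)))))"
  have X: "X > 0" using a x by (simp add: X_def)
  have r: "r > 0" by (simp add: r_def)
  have r': "Re \<nu> + r > 0" using nu r by simp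
  have cont: "continuous_on {0<..} (f n)" for n
    unfolding f_def by (intro continuous_intros) auto
  have bound: "norm (f n t) \<le> (r powr r * X powr (- r)) * (real n + 1) powr (- 2) * (t powr (Re \<nu> + r - 1) * exp (- t))"
    if t: "t > 0" for n t
  proof -
    define N where "N = real (Suc n)"
    have N: "N > 0" by (simp add: N_def)
    have "norm (f n t) = t powr (Re \<nu> - 1) * exp (- t) * (\<bar>\<sigma> (Suc n)\<bar> * exp (- (N * (X / t))))"
      using t by (simp add: f_def norm_mult norm_powr_real_powr N_def abs_mult)
    also have "\<dots> \<le> t powr (Re \<nu> - 1) * exp (- t) * (N powr (real (Suc k)) * (r powr r * (N * (X / t)) powr (- r)))"
    proof (intro mult_left_mono mult_mono)
      have "N powr real (Suc k) = N ^ Suc k" using N by (rule powr_realpow)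
      thus "\<bar>\<sigma> (Suc n)\<bar> \<le> N powr real (Suc k)"
        using divisor_sum_bound[OF c, of "Suc n"] by (simp add: \<sigma>_def N_def del: power_Suc)
      show "exp (- (N * (X / t))) \<le> r powr r * (N * (X / t)) powr (- r)"
        using X t N by (intro exp_minus_le_powr r) auto
    qed auto
    also have "(N * (X / t)) powr (- r) = N powr (- r) * (X powr (- r) * t powr r)"
      using X t N by (simp add: powr_mult powr_divide powr_minus divide_simps)
    also have "t powr (Re \<nu> - 1) * exp (- t) * (N powr (real (Suc k)) * (r powr r * (N powr (- r) * (X powr (- r) * t powr r))))
       = (r powr r * X powr (- r)) * (N powr (real (Suc k)) * N powr (- r)) * (t powr (Re \<nu> - 1) * t powr r * exp (- t))"
      by (simp only: mult_ac)
    also have "N powr (real (Suc k)) * N powr (- r) = N powr (- 2)"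
      unfolding powr_add [symmetric] by (simp add: r_def)
    also have "t powr (Re \<nu> - 1) * t powr r = t powr (Re \<nu> + r - 1)"
      unfolding powr_add [symmetric] by (simp add: algebra_simps)
    finally show ?thesis by (simp add: N_def add.commute)
  qed
  have b: "summable (\<lambda>n. (r powr r * X powr (- r)) * (real n + 1) powr (- 2))"
    by (intro summable_mult summable_shifted_powr) auto
  have sums: "(\<lambda>n. integral {0<..} (f n)) sums integral {0<..} (\<lambda>t. \<Sum>n. f n t)"
    by (rule integral_series(2)[OF cont Gamma_integrand_real[OF r'] bound b])
  have X0: "complex_of_real X powr (\<nu> / 2) \<noteq> 0" using X by simp
  have term_eq: "integral {0<..} (f n) / (2 * complex_of_real X powr (\<nu> / 2)) =
     complex_of_real (real (Suc n)) powr (\<nu> / 2) * besselK \<nu> (a * sqrt (real (Suc n) * x)) * complex_of_real (\<sigma> (Suc n))" for n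
  proof -
    define N where "N = real (Suc n)"
    define z where "z = a * sqrt (N * x)"
    have N: "N > 0" by (simp add: N_def)
    have z: "z > 0" using a x N by (simp add: z_def)
    have zX: "z^2 / 4 = N * X" using N x by (simp add: z_def X_def power_mult_distrib)
    have f_eq: "f n = (\<lambda>t. complex_of_real (\<sigma> (Suc n)) * (complex_of_real t powr (\<nu> - 1) * complex_of_real (exp (- t)) * complex_of_real (exp (- (z^2 / 4 / t)))))"
      unfolding f_def zX by (simp add: N_def fun_eq_iff mult_ac)
    have "integral {0<..} (f n) = complex_of_real (\<sigma> (Suc n)) * (2 * complex_of_real (z / 2) powr \<nu> * besselK \<nu> z)"
      unfolding f_eq integral_mult_right besselK_integral[OF nu z] ..
    also have "complex_of_real (z / 2) powr \<nu> = complex_of_real N powr (\<nu> / 2) * complex_of_real X powr (\<nu> / 2)"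
    proof -
      \<comment> \<open>Since (z / 2)^2 = N X, the power (z / 2)^\<nu> splits into the \<nu>/2-th
        powers of N and X; for a complex exponent this is checked on logarithms of positive
        reals.\<close>
      have "ln (z / 2) = ln ((z / 2)^2) / 2" using z by (simp add: ln_realpow)
      also have "(z / 2)^2 = N * X" using zX by (simp add: power_divide)
      finally have ln_eq: "ln (z / 2) = ln (N * X) / 2" .
      have "complex_of_real (z / 2) powr \<nu> = exp (\<nu> * complex_of_real (ln (z / 2)))"
        using z by (simp add: powr_def Ln_of_real del: of_real_divide)
      also have "\<dots> = exp (\<nu> / 2 * complex_of_real (ln (N * X)))"
        unfolding ln_eq by simp
      also have "\<dots> = complex_of_real (N * X) powr (\<nu> / 2)"
        using N X by (simp add: powr_def Ln_of_real del: of_real_mult)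
      also have "\<dots> = complex_of_real N powr (\<nu> / 2) * complex_of_real X powr (\<nu> / 2)"
        unfolding of_real_mult by (rule powr_times_real) (use N X in auto)
      finally show ?thesis .
    qed
    finally show ?thesis using X0 by (simp add: z_def N_def field_simps)
  qed
  from sums_divide[OF sums, of "2 * complex_of_real X powr (\<nu> / 2)"]
  show ?thesis unfolding term_eq unfolding f_def .
qed

section \<open>The exponential double series as Gamma integrals\<close>

lemma exponential_double_series:
  fixes \<nu> :: complex and k :: nat
  assumes B: "\<beta> > 0" and th: "0 < \<theta>" "\<theta> < 1" and nu: "Re \<nu> > 0"
  defines "s \<equiv> \<nu> + of_nat k + 1"
  defines "f \<equiv> (\<lambda>m n t. complex_of_real (real (Suc m) ^ k) *
      (complex_of_real t powr (s - 1) * complex_of_real (exp (- ((\<beta> * (real (Suc m) * (real n + \<theta>)) + 1) * t)))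
     + complex_of_real t powr (s - 1) * complex_of_real (exp (- ((\<beta> * (real (Suc m) * (real n + 1 - \<theta>)) + 1) * t)))))"
  shows "((\<lambda>t. \<Sum>n. \<Sum>m. f m n t) has_integral
     Gamma s * (\<Sum>m. complex_of_real (real (Suc m) ^ k) * (\<Sum>n.
         1 / complex_of_real (\<beta> * (real (Suc m) * (real n + \<theta>)) + 1) powr s
       + 1 / complex_of_real (\<beta> * (real (Suc m) * (real n + 1 - \<theta>)) + 1) powr s))) {0<..}"
proof -
  \<comment> \<open>Re \<nu> is split into two halves. With \<open>q = k + 1 + e\<close>, one half
    makes D^k D^-q = D^-(1+e) summable over D = m + 1; the other keeps t^(Re s - 1 - q) = t^(e-1)
    integrable at 0.\<close>
  define e where "e = Re \<nu> / 2"
  define q where "q = real k + 1 + e"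
  have e: "e > 0" and q: "q > 1" using nu by (simp_all add: e_def q_def add_nonneg_pos)
  have Re_s: "Re s > 0" using nu by (simp add: s_def)
  define G where "G = (\<lambda>t::real. t powr (e - 1) * exp (- t))"
  define g where "g = (\<lambda>m. (q powr q * \<beta> powr (- q)) * (real m + 1) powr (- (1 + e)))"
  define h where "h = (\<lambda>n. (real n + \<theta>) powr (- q) + (real n + (1 - \<theta>)) powr (- q))"
  have cont: "continuous_on {0<..} (f m n)" for m n
    unfolding f_def by (intro continuous_intros) auto
  have G: "G absolutely_integrable_on {0<..}"
    unfolding G_def by (rule Gamma_integrand_real[OF e])
  have term_bound: "real (Suc m) ^ k * (t powr (Re s - 1) * exp (- ((\<beta> * (real (Suc m) * u) + 1) * t))) \<le> g m * u powr (- q) * G t"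
    if t: "t > 0" and u: "u > 0" for t u :: real and m :: nat
  proof -
    define D where "D = real (Suc m)"
    have D: "D > 0" by (simp add: D_def)
    have Dk: "D ^ k = D powr real k" using D by (simp add: powr_realpow)
    have "exp (- ((\<beta> * (D * u) + 1) * t)) = exp (- t) * exp (- (\<beta> * (D * u) * t))"
      by (simp add: algebra_simps flip: exp_add)
    also have "\<dots> \<le> exp (- t) * (q powr q * (\<beta> * (D * u) * t) powr (- q))"
      using q B D t u by (intro mult_left_mono exp_minus_le_powr) auto
    also have "(\<beta> * (D * u) * t) powr (- q) = \<beta> powr (- q) * (D powr (- q) * u powr (- q)) * t powr (- q)"
      using B D t u by (simp add: powr_mult)
    finally have "D ^ k * (t powr (Re s - 1) * exp (- ((\<beta> * (D * u) + 1) * t))) \<le>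
       D ^ k * (t powr (Re s - 1) * (exp (- t) * (q powr q * (\<beta> powr (- q) * (D powr (- q) * u powr (- q)) * t powr (- q)))))"
      using D by (intro mult_left_mono) auto
    also have "\<dots> = (q powr q * \<beta> powr (- q)) * (D powr real k * D powr (- q)) * u powr (- q) * (t powr (Re s - 1) * t powr (- q) * exp (- t))"
      unfolding Dk by (simp only: mult_ac)
    also have "D powr real k * D powr (- q) = D powr (- (1 + e))"
      unfolding powr_add [symmetric] by (simp add: q_def)
    also have "t powr (Re s - 1) * t powr (- q) = t powr (e - 1)"
      unfolding powr_add [symmetric] by (simp add: q_def s_def e_def)
    finally show ?thesis by (simp add: g_def G_def D_def add.commute)
  qed
  have bound: "norm (f m n t) \<le> g m * h n * G t" if t: "t > 0" for m n t
  proof -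
    let ?E = "\<lambda>u. t powr (Re s - 1) * exp (- ((\<beta> * (real (Suc m) * u) + 1) * t))"
    have "norm (f m n t) = real (Suc m) ^ k * norm
      (complex_of_real t powr (s - 1) * complex_of_real (exp (- ((\<beta> * (real (Suc m) * (real n + \<theta>)) + 1) * t)))
     + complex_of_real t powr (s - 1) * complex_of_real (exp (- ((\<beta> * (real (Suc m) * (real n + 1 - \<theta>)) + 1) * t))))"
      unfolding f_def by (simp only: norm_mult norm_of_real) simp
    also have "\<dots> \<le> real (Suc m) ^ k * (?E (real n + \<theta>) + ?E (real n + 1 - \<theta>))"
    proof (intro mult_left_mono norm_triangle_le)
      have "norm (complex_of_real t powr (s - 1) * complex_of_real (exp w)) = t powr (Re s - 1) * exp w" for w
        using t by (simp add: norm_mult norm_powr_real_powr)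
      thus "norm (complex_of_real t powr (s - 1) * complex_of_real (exp (- ((\<beta> * (real (Suc m) * (real n + \<theta>)) + 1) * t))))
         + norm (complex_of_real t powr (s - 1) * complex_of_real (exp (- ((\<beta> * (real (Suc m) * (real n + 1 - \<theta>)) + 1) * t))))
         \<le> ?E (real n + \<theta>) + ?E (real n + 1 - \<theta>)" by simp
    qed auto
    also have "\<dots> = real (Suc m) ^ k * ?E (real n + \<theta>) + real (Suc m) ^ k * ?E (real n + 1 - \<theta>)"
      by (rule distrib_left)
    also have "\<dots> \<le> g m * (real n + \<theta>) powr (- q) * G t + g m * (real n + 1 - \<theta>) powr (- q) * G t"
      using th t by (intro add_mono term_bound) auto
    also have "\<dots> = g m * h n * G t" by (simp add: h_def algebra_simps)
    finally show ?thesis .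
  qed
  have gs: "summable g"
    unfolding g_def by (intro summable_mult summable_shifted_powr) (use e in auto)
  have hs: "summable h"
    unfolding h_def by (intro summable_add summable_shifted_powr) (use q th in auto)
  have nonneg: "g m \<ge> 0" "h n \<ge> 0" for m n
    by (auto simp: g_def h_def)
  note series = integral_double_series[OF cont G bound gs hs nonneg]
  have int_eq: "integral {0<..} (f m n) = Gamma s * complex_of_real (real (Suc m) ^ k) *
      (1 / complex_of_real (\<beta> * (real (Suc m) * (real n + \<theta>)) + 1) powr s
       + 1 / complex_of_real (\<beta> * (real (Suc m) * (real n + 1 - \<theta>)) + 1) powr s)" for m n
  proof -
    have integrable: "(\<lambda>t. complex_of_real t powr (s - 1) * complex_of_real (exp (- (C * t)))) integrable_on {0<..}" if "C \<ge> 1" for C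
    proof (rule set_lebesgue_integral_eq_integral(1))
      show "(\<lambda>t. complex_of_real t powr (s - 1) * complex_of_real (exp (- (C * t)))) absolutely_integrable_on {0<..}"
      proof (rule absolutely_integrable_continuous_dominated[OF _ Gamma_integrand_real[OF Re_s]])
        show "continuous_on {0<..} (\<lambda>t. complex_of_real t powr (s - 1) * complex_of_real (exp (- (C * t))))"
          by (intro continuous_intros) auto
        fix t :: real assume t: "t > 0"
        have "1 * t \<le> C * t" using that t by (intro mult_right_mono) auto
        thus "norm (complex_of_real t powr (s - 1) * complex_of_real (exp (- (C * t)))) \<le> 1 * (t powr (Re s - 1) * exp (- t))"
          using t by (simp add: norm_mult norm_powr_real_powr mult_left_mono)
      qed
    qed
    have C: "\<beta> * (real (Suc m) * (real n + \<theta>)) + 1 \<ge> 1" "\<beta> * (real (Suc m) * (real n + 1 - \<theta>)) + 1 \<ge> 1"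
      using B th by auto
    show ?thesis
      unfolding f_def integral_mult_right
      by (subst integral_add[OF integrable[OF C(1)] integrable[OF C(2)]],
          subst Gamma_integral_scaled[OF Re_s], use C in linarith,
          subst Gamma_integral_scaled[OF Re_s], use C in linarith)
         (simp add: algebra_simps)
  qed
  \<comment> \<open>Gamma has no zeros, so it can be cancelled: summability of the sums of
    \<open>Y\<close> is read off from that of the integrals, which lets the constants be pulled
    out.\<close>
  have Gs: "Gamma s \<noteq> 0" using Re_s by (auto simp: Gamma_eq_zero_iff elim!: nonpos_Ints_cases)
  define Y where "Y = (\<lambda>m n. 1 / complex_of_real (\<beta> * (real (Suc m) * (real n + \<theta>)) + 1) powr s
       + 1 / complex_of_real (\<beta> * (real (Suc m) * (real n + 1 - \<theta>)) + 1) powr s)"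
  have int_Y: "integral {0<..} (f m n) = Gamma s * complex_of_real (real (Suc m) ^ k) * Y m n" for m n
    unfolding int_eq Y_def ..
  note conv = iterated_sums_infsum[OF series(2)]
  have inner: "(\<Sum>n. integral {0<..} (f m n)) = Gamma s * (complex_of_real (real (Suc m) ^ k) * (\<Sum>n. Y m n))" for m
  proof -
    have c0: "Gamma s * complex_of_real (real (Suc m) ^ k) \<noteq> 0" using Gs by (simp del: of_nat_Suc)
    have "summable (\<lambda>n. integral {0<..} (f m n))"
      using conv(1) by (rule summable_norm_cancel)
    hence "summable (\<lambda>n. Gamma s * complex_of_real (real (Suc m) ^ k) * Y m n)"
      unfolding int_Y .
    hence "summable (Y m)" using c0 by (simp only: summable_cmult_iff simp_thms)
    from suminf_mult[OF this, of "Gamma s * complex_of_real (real (Suc m) ^ k)"]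
    show ?thesis unfolding int_Y by (simp only: mult.assoc)
  qed
  have "summable (\<lambda>m. \<Sum>n. integral {0<..} (f m n))"
    using conv(2) by (rule sums_summable)
  hence "summable (\<lambda>m. complex_of_real (real (Suc m) ^ k) * (\<Sum>n. Y m n))"
    unfolding inner using Gs by (simp only: summable_cmult_iff simp_thms)
  note outer = suminf_mult[OF this, of "Gamma s"]
  have "integral {0<..} (\<lambda>t. \<Sum>n. \<Sum>m. f m n t) = (\<Sum>m. \<Sum>n. integral {0<..} (f m n))"
    by (rule series(3))
  also have "\<dots> = Gamma s * (\<Sum>m. complex_of_real (real (Suc m) ^ k) * (\<Sum>n. Y m n))"
    unfolding inner by (rule outer)
  finally have "integral {0<..} (\<lambda>t. \<Sum>n. \<Sum>m. f m n t) = Gamma s * (\<Sum>m. complex_of_real (real (Suc m) ^ k) * (\<Sum>n. Y m n))" .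
  thus ?thesis
    using set_lebesgue_integral_eq_integral(1)[OF series(1)] unfolding Y_def
    by (simp only: has_integral_integrable_integral simp_thms)
qed

section \<open>Assembly of the two sides\<close>

theorem theorem2p8:
  fixes a x \<theta> :: real and k :: nat and \<nu> :: complex
  assumes "a > 0" and "x > 0" and "0 < \<theta>" and "\<theta> < 1" and "odd k" and "Re \<nu> > 0"
  shows "complex_of_real (a^2 * x / 4) powr (\<nu> / 2 + of_nat k + 1) *
      (\<Sum>n. complex_of_real (real (Suc n)) powr (\<nu> / 2) * besselK \<nu> (a * sqrt (real (Suc n) * x)) *
           complex_of_real (\<Sum>d | d dvd Suc n. real d ^ k * cos (2 * pi * real d * \<theta>)))
    = complex_of_real ((-1) ^ ((k - 1) div 2) * a ^ (2*k+2) * fact k / (2 ^ (2*k+4) * (2*pi) ^ (k+1))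
          * (hurwitz_zeta (real k + 1) \<theta> + hurwitz_zeta (real k + 1) (1 - \<theta>)) * x ^ (k+1)) * Gamma \<nu>
      + complex_of_real ((-1) ^ ((k + 1) div 2) * (2*pi) ^ (k+1) / 4) * Gamma (\<nu> + of_nat k + 1) *
        (\<Sum>d. complex_of_real (real (Suc d) ^ k) *
           (\<Sum>m. 1 / complex_of_real (16 * pi^2 / a^2 * (real (Suc d) * (real m + \<theta>)) / x + 1) powr (\<nu> + of_nat k + 1)
                + 1 / complex_of_real (16 * pi^2 / a^2 * (real (Suc d) * (real m + 1 - \<theta>)) / x + 1) powr (\<nu> + of_nat k + 1)))
      - (if k = 1 then complex_of_real (a^2 / 16 * x) * Gamma (1 + \<nu>) else 0)"
proof -
  define X where "X = a^2 * x / 4"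
  define \<beta> where "\<beta> = 4 * pi^2 / X"
  define s where "s = \<nu> + of_nat k + 1"
  define c where "c = (\<lambda>d. real d ^ k * cos (2 * pi * real d * \<theta>))"
  define \<sigma> where "\<sigma> = (\<lambda>N. \<Sum>d | d dvd N. c d)"
  define \<epsilon> :: real where "\<epsilon> = (-1) ^ ((k + 1) div 2)"
  define P where "P = (2 * pi) ^ Suc k"
  define Z where "Z = hurwitz_zeta (real k + 1) \<theta> + hurwitz_zeta (real k + 1) (1 - \<theta>)"
  define Q where "Q = (\<lambda>t. complex_of_real t powr (\<nu> - 1) * complex_of_real (exp (- t)))"
  define E where "E = (\<lambda>t \<alpha> n. \<Sum>d. real d ^ k * exp (- (4 * pi^2 / (X / t) * (real d * (real n + \<alpha>)))))"
  define f where "f = (\<lambda>m n t. complex_of_real (real (Suc m) ^ k) *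
      (complex_of_real t powr (s - 1) * complex_of_real (exp (- ((\<beta> * (real (Suc m) * (real n + \<theta>)) + 1) * t)))
     + complex_of_real t powr (s - 1) * complex_of_real (exp (- ((\<beta> * (real (Suc m) * (real n + 1 - \<theta>)) + 1) * t)))))"
  define \<Phi> where "\<Phi> = (\<lambda>t. \<Sum>n. Q t * complex_of_real (\<sigma> (Suc n) * exp (- (real (Suc n) * (X / t)))))"
  define \<Sigma> where "\<Sigma> = (\<Sum>m. complex_of_real (real (Suc m) ^ k) * (\<Sum>n.
         1 / complex_of_real (\<beta> * (real (Suc m) * (real n + \<theta>)) + 1) powr s
       + 1 / complex_of_real (\<beta> * (real (Suc m) * (real n + 1 - \<theta>)) + 1) powr s))"
  \<comment> \<open>\<open>V\<close> is the integral of X^(k+1) \<open>\<Phi>\<close>(t), evaluated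
    through the transformation formula. The theorem's right-hand side is \<open>V / 2\<close>; the 2
    stems from \<open>besselK_integral\<close>.\<close>
  define V where "V = complex_of_real (\<epsilon> * P / 2) * (Gamma s * \<Sigma>)
      - complex_of_real (\<epsilon> * fact k * Z / (2 * P) * X ^ Suc k) * Gamma \<nu>
      - (if k = 1 then complex_of_real (X / 2) * Gamma (\<nu> + 1) else 0)"
  have X: "X > 0" and B: "\<beta> > 0" using assms by (simp_all add: X_def \<beta>_def)
  have k0: "k > 0" using \<open>odd k\<close> by (auto intro!: Nat.gr0I)
  have c_bound: "\<bar>c d\<bar> \<le> real d ^ k" for d
    using mult_left_mono[of "\<bar>cos (2 * pi * real d * \<theta>)\<bar>" 1 "real d ^ k"]
    by (simp add: c_def abs_mult)
  have c0: "c 0 = 0" using k0 by (simp add: c_def)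
  have th': "0 < 1 - \<theta>" "1 - \<theta> < 1" using assms by auto

  \<comment> \<open>At y = X / t the rate 4 pi^2 / y is \<beta> t. The series in \<open>E\<close>
    start at d = 0, where the term vanishes as \<open>k > 0\<close>, so they can be reindexed from
    1.\<close>
  have E_sums: "(\<lambda>m. real (Suc m) ^ k * exp (- (\<beta> * (real (Suc m) * (real n + \<alpha>)) * t))) sums E t \<alpha> n"
    if t: "t > 0" and al: "\<alpha> > 0" for t \<alpha> :: real and n :: nat
  proof -
    define e where "e = (\<lambda>d. real d ^ k * exp (- (4 * pi^2 / (X / t) * (real d * (real n + \<alpha>)))))"
    have e_eq: "e d = real d ^ k * exp (- (\<beta> * (real d * (real n + \<alpha>)) * t))" for d
      by (simp add: e_def \<beta>_def mult_ac)
    have "norm (exp (- (\<beta> * (real n + \<alpha>) * t))) < 1" using B t al by simp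
    from summable_power_times_geometric[OF this, of k]
    have "summable e" unfolding e_eq by (simp add: mult_ac flip: exp_of_nat_mult)
    hence sm: "summable (\<lambda>m. e (Suc m))" by (subst summable_Suc_iff)
    have "suminf e = (\<Sum>m. e (Suc m))"
      using suminf_shift_zero[OF sm] k0 by (simp add: e_def)
    with summable_sums[OF sm] have "(\<lambda>m. e (Suc m)) sums suminf e" by simp
    moreover have "suminf e = E t \<alpha> n" by (simp only: E_def e_def)
    ultimately show ?thesis unfolding e_eq by simp
  qed

  \<comment> \<open>The transformation at y = X / t, multiplied by X^(k+1). The factor (X / y)^(k+1)
    = t^(k+1) turns t^(\<nu>-1) into t^(s-1), and for \<open>k = 1\<close> the defect X^2 / (2 y)
    becomes X t / 2, which shifts \<nu> to \<nu> + 1 in the Gamma integral.\<close>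
  have pointwise: "complex_of_real (\<epsilon> * P / 2) * (\<Sum>n. \<Sum>m. f m n t)
      - complex_of_real (\<epsilon> * fact k * Z / (2 * P) * X ^ Suc k) * Q t
      - (if k = 1 then complex_of_real (X / 2) * (complex_of_real t powr (\<nu> + 1 - 1) * complex_of_real (exp (- t))) else 0)
      = complex_of_real (X ^ Suc k) * \<Phi> t" if t: "t \<in> {0<..}" for t
  proof -
    have t0: "t > 0" and y: "X / t > 0" using t X by auto
    define S where "S = suminf (E t \<theta>) + suminf (E t (1 - \<theta>))"
    note tr = twisted_divisor_series_transformation[OF y assms(3,4,5)]
    have "(\<lambda>N. \<sigma> (Suc N) * exp (- (real (Suc N) * (X / t)))) sums
       (\<epsilon> * P / (2 * (X / t) ^ Suc k) * S - \<epsilon> * fact k / (2 * P) * Z - (if k = 1 then 1 / (2 * (X / t)) else 0))"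
      (is "_ sums ?T")
      using divisor_exponential_sums[OF y c_bound c0] sums_unique[OF tr(3)]
      by (simp only: \<sigma>_def \<epsilon>_def P_def Z_def S_def E_def c_def Suc_eq_plus1)
    from sums_mult[OF sums_of_real[OF this], of "Q t"]
    have Phi: "\<Phi> t = Q t * complex_of_real ?T"
      unfolding \<Phi>_def by (rule sums_unique [symmetric])
    have powr_shift: "complex_of_real t powr (s - 1) = complex_of_real (t ^ Suc k) * complex_of_real t powr (\<nu> - 1)"
    proof -
      have "complex_of_real t powr (s - 1) = complex_of_real t powr (of_nat (Suc k) + (\<nu> - 1))"
        by (simp add: s_def algebra_simps)
      also have "\<dots> = complex_of_real t powr of_nat (Suc k) * complex_of_real t powr (\<nu> - 1)"
        by (rule powr_add)
      also have "complex_of_real t powr of_nat (Suc k) = complex_of_real (t ^ Suc k)"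
        using t0 by (subst powr_nat') auto
      finally show ?thesis .
    qed
    have f_eq: "f m n t = complex_of_real (t ^ Suc k) * Q t * complex_of_real
        (real (Suc m) ^ k * exp (- (\<beta> * (real (Suc m) * (real n + \<theta>)) * t)) +
         real (Suc m) ^ k * exp (- (\<beta> * (real (Suc m) * (real n + (1 - \<theta>))) * t)))" for m n
    proof -
      have ex: "exp (- ((w + 1) * t)) = exp (- t) * exp (- (w * t))" for w
        by (simp add: algebra_simps flip: exp_add)
      have "real n + 1 - \<theta> = real n + (1 - \<theta>)" by simp
      thus ?thesis
        unfolding f_def powr_shift Q_def ex
        by (simp only: of_real_mult of_real_add distrib_left mult_ac)
    qed
    have "(\<Sum>m. f m n t) = complex_of_real (t ^ Suc k) * Q t * complex_of_real (E t \<theta> n + E t (1 - \<theta>) n)" for n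
      unfolding f_eq
      by (intro sums_unique [symmetric] sums_mult sums_of_real sums_add E_sums t0 assms(3) th'(1))
    moreover have "(\<lambda>n. complex_of_real (t ^ Suc k) * Q t * complex_of_real (E t \<theta> n + E t (1 - \<theta>) n)) sums
        (complex_of_real (t ^ Suc k) * Q t * complex_of_real S)"
      unfolding S_def using tr(1,2)
      by (intro sums_mult sums_of_real sums_add summable_sums) (simp_all add: E_def)
    ultimately have sum_f: "(\<Sum>n. \<Sum>m. f m n t) = complex_of_real (t ^ Suc k) * Q t * complex_of_real S"
      by (simp only: sums_iff)
    have T: "X ^ Suc k * ?T = \<epsilon> * P / 2 * (t ^ Suc k * S) - \<epsilon> * fact k * Z / (2 * P) * X ^ Suc k
        - (if k = 1 then X / 2 * t else 0)"
    proof -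
      have "X ^ Suc k * (\<epsilon> * P / (2 * (X / t) ^ Suc k) * S) = \<epsilon> * P / 2 * (t ^ Suc k * S)"
        using X by (simp add: power_divide del: power_Suc)
      moreover have "X ^ Suc k * (\<epsilon> * fact k / (2 * P) * Z) = \<epsilon> * fact k * Z / (2 * P) * X ^ Suc k"
        by simp
      moreover have "X ^ Suc k * (if k = 1 then 1 / (2 * (X / t)) else 0) = (if k = 1 then X / 2 * t else 0)"
        using X t0 by (simp add: power2_eq_square)
      ultimately show ?thesis by (simp only: right_diff_distrib)
    qed
    have nu1: "complex_of_real t powr (\<nu> + 1 - 1) = complex_of_real t * complex_of_real t powr (\<nu> - 1)"
      using t0 by (simp add: powr_diff)
    have "complex_of_real (X ^ Suc k) * \<Phi> t = complex_of_real (X ^ Suc k * ?T) * Q t"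
      unfolding Phi of_real_mult by (simp only: mult_ac)
    also have "\<dots> = complex_of_real (\<epsilon> * P / 2) * (\<Sum>n. \<Sum>m. f m n t)
      - complex_of_real (\<epsilon> * fact k * Z / (2 * P) * X ^ Suc k) * Q t
      - (if k = 1 then complex_of_real (X / 2) * (complex_of_real t powr (\<nu> + 1 - 1) * complex_of_real (exp (- t))) else 0)"
    proof -
      have "complex_of_real (if k = 1 then X / 2 * t else 0) * Q t =
        (if k = 1 then complex_of_real (X / 2) * (complex_of_real t powr (\<nu> + 1 - 1) * complex_of_real (exp (- t))) else 0)"
        unfolding nu1 Q_def by simp
      moreover have "complex_of_real (\<epsilon> * P / 2 * (t ^ Suc k * S)) * Q t = complex_of_real (\<epsilon> * P / 2) * (\<Sum>n. \<Sum>m. f m n t)"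
        unfolding sum_f of_real_mult by (simp only: mult_ac)
      ultimately show ?thesis unfolding T of_real_diff by (simp only: left_diff_distrib)
    qed
    finally show ?thesis by simp
  qed

  have Gamma_part: "((\<lambda>t. if k = 1 then complex_of_real (X / 2) * (complex_of_real t powr (\<nu> + 1 - 1) * complex_of_real (exp (- t))) else 0)
      has_integral (if k = 1 then complex_of_real (X / 2) * Gamma (\<nu> + 1) else 0)) {0<..}"
  proof (cases "k = 1")
    case True
    have "Re (\<nu> + 1) > 0" using assms by simp
    from has_integral_mult_right[OF Gamma_integrand(2)[OF this], of "complex_of_real (X / 2)"] True
    show ?thesis by (simp only: simp_thms if_True)
  qed simp
  have "((\<lambda>t. complex_of_real (\<epsilon> * P / 2) * (\<Sum>n. \<Sum>m. f m n t)
      - complex_of_real (\<epsilon> * fact k * Z / (2 * P) * X ^ Suc k) * Q t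
      - (if k = 1 then complex_of_real (X / 2) * (complex_of_real t powr (\<nu> + 1 - 1) * complex_of_real (exp (- t))) else 0))
      has_integral V) {0<..}"
    unfolding V_def Q_def \<Sigma>_def f_def s_def
    by (intro has_integral_diff has_integral_mult_right Gamma_part Gamma_integrand(2) assms
        exponential_double_series[OF B assms(3,4,6)])
  from has_integral_eq[OF pointwise this]
  have "((\<lambda>t. complex_of_real (X ^ Suc k) * \<Phi> t) has_integral V) {0<..}" .
  hence I: "complex_of_real (X ^ Suc k) * integral {0<..} \<Phi> = V"
    by (simp only: integral_mult_right [symmetric] integral_unique)

  have X0: "complex_of_real X powr (\<nu> / 2) \<noteq> 0" using X by simp
  have "(\<Sum>n. complex_of_real (real (Suc n)) powr (\<nu> / 2) * besselK \<nu> (a * sqrt (real (Suc n) * x)) *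
           complex_of_real (\<sigma> (Suc n))) = integral {0<..} \<Phi> / (2 * complex_of_real X powr (\<nu> / 2))"
    unfolding \<Phi>_def Q_def \<sigma>_def X_def
    by (rule sums_unique [symmetric], rule bessel_divisor_series[OF assms(1,2,6) c_bound])
  \<comment> \<open>The \<nu>/2 in the prefactor cancels the power of X left by the Bessel integral;
    the remaining k + 1 is the power that cleared y^(k+1).\<close>
  moreover have "complex_of_real X powr (\<nu> / 2 + of_nat k + 1) = complex_of_real X powr (\<nu> / 2) * complex_of_real (X ^ Suc k)"
  proof -
    have "complex_of_real X powr (\<nu> / 2 + of_nat k + 1) = complex_of_real X powr (\<nu> / 2 + of_nat (Suc k))"
      by (simp add: algebra_simps)
    also have "\<dots> = complex_of_real X powr (\<nu> / 2) * complex_of_real X powr of_nat (Suc k)"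
      by (rule powr_add)
    also have "complex_of_real X powr of_nat (Suc k) = complex_of_real (X ^ Suc k)"
      using X by (subst powr_nat') auto
    finally show ?thesis .
  qed
  ultimately have lhs: "complex_of_real X powr (\<nu> / 2 + of_nat k + 1) *
      (\<Sum>n. complex_of_real (real (Suc n)) powr (\<nu> / 2) * besselK \<nu> (a * sqrt (real (Suc n) * x)) *
           complex_of_real (\<sigma> (Suc n))) = V / 2"
    using X0 unfolding I [symmetric] by (simp del: power_Suc)

  \<comment> \<open>With X = a^2 x / 4, \<beta> equals 16 pi^2 / (a^2 x).\<close>
  have arg: "16 * pi^2 / a^2 * w / x + 1 = \<beta> * w + 1" for w
    using assms(1,2) by (simp add: \<beta>_def X_def)
  have sign: "(-1) ^ ((k - 1) div 2) = - \<epsilon>"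
    using \<open>odd k\<close> by (elim oddE) (simp add: \<epsilon>_def)
  \<comment> \<open>X^(k+1) contributes 2^(2k+2) to the denominator and two further halvings make it
    2^(2k+4). The sign flips because (k + 1) / 2 is one more than (k - 1) / 2.\<close>
  have zeta_coeff: "(-1) ^ ((k - 1) div 2) * a ^ (2*k+2) * fact k / (2 ^ (2*k+4) * (2*pi) ^ (k+1)) * Z * x ^ (k+1)
     = - (\<epsilon> * fact k * Z / (2 * P) * X ^ Suc k) / 2"
  proof -
    have "X ^ Suc k = a ^ (2*k+2) * x ^ (k+1) / 2 ^ (2*k+2)"
    proof -
      have "b ^ (2*k+2) = (b^2) ^ Suc k" for b :: real
        by (simp add: power_mult power2_eq_square)
      from this[of a] this[of 2] show ?thesis
        by (simp only: X_def power_divide power_mult_distrib Suc_eq_plus1) simp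
    qed
    moreover have "(2::real) ^ (2*k+4) = 4 * 2 ^ (2*k+2)" by (simp add: power_add)
    ultimately show ?thesis unfolding sign P_def Suc_eq_plus1 by (simp add: mult_ac)
  qed
  have "V / 2 = complex_of_real (- (\<epsilon> * fact k * Z / (2 * P) * X ^ Suc k) / 2) * Gamma \<nu>
      + complex_of_real (\<epsilon> * (2*pi) ^ (k+1) / 4) * Gamma s * \<Sigma>
      - (if k = 1 then complex_of_real (a^2 / 16 * x) * Gamma (1 + \<nu>) else 0)"
    unfolding V_def P_def X_def [symmetric] by (simp add: X_def algebra_simps diff_divide_distrib)
  thus ?thesis
    unfolding lhs [unfolded \<sigma>_def c_def X_def] arg
    unfolding Z_def [symmetric] zeta_coeff \<epsilon>_def [symmetric] s_def [symmetric] \<Sigma>_def .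
qed

end
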